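(* Let $C$ be an additive cyclic order on $\mathbb{Z}$, i.e. let $(\mathbb{Z};+,C)$ be a cyclically ordered abelian group. Then the structure $(\mathbb{Z};+,C)$ is dp-minimal.
   Context: A cyclic order on a set $G$ is a ternary relation $C\subseteq G^3$ such that for all $a,b,c,d\in G$: (1) if $(a,b,c)\in C$ then $(b,c,a)\in C$; (2) if $(a,b,c)\in C$ then $(c,b,a)\notin C$; (3) if $(a,b,c)\in C$ and $(a,c,d)\in C$ then $(a,b,d)\in C$; (4) if $a,b,c$ are distinct then $(a,b,c)\in C$ or $(c,b,a)\in C$. A cyclic order $C$ on the underlying set of an abelian group $(G;+)$ is additive if it is preserved by the group operation: $(a,b,c)\in C$ implies $(a+d,b+d,c+d)\in C$ for all $d \in G$. In that case $(G;+,C)$ is called a cyclically ordered abelian group. Here $+$ on $\mathbb{Z}$ is the usual addition. A structure $\mathscr{M}$ is dp-minimal if (the standard definition) its theory has no ict-pattern of depth two in one variable: there are no formulas $\varphi(x;y)$, $\psi(x;z)$ with $x$ a single variable ($y,z$ tuples of variables) and sequences $(a_i)_{i\in\mathbb{N}}$, $(b_j)_{j\in\mathbb{N}}$ of tuples in an elementary extension of $\mathscr{M}$ such that for all $i,j\in\mathbb{N}$ the set of formulas $\{\varphi(x;a_i),\psi(x;b_j)\}\cup\{\neg\varphi(x;a_{i'}): i'\neq i\}\cup\{\neg\psi(x;b_{j'}): j'\neq j\}$ is consistent. *)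

theory Defs
  imports Main
begin

definition cyclic_order_on :: "'a set \<Rightarrow> ('a \<times> 'a \<times> 'a) set \<Rightarrow> bool" where
  "cyclic_order_on G C \<longleftrightarrow>
     C \<subseteq> G \<times> G \<times> G \<and>
     (\<forall>a\<in>G. \<forall>b\<in>G. \<forall>c\<in>G. (a, b, c) \<in> C \<longrightarrow> (b, c, a) \<in> C) \<and>
     (\<forall>a\<in>G. \<forall>b\<in>G. \<forall>c\<in>G. (a, b, c) \<in> C \<longrightarrow> (c, b, a) \<notin> C) \<and>
     (\<forall>a\<in>G. \<forall>b\<in>G. \<forall>c\<in>G. \<forall>d\<in>G.
        (a, b, c) \<in> C \<and> (a, c, d) \<in> C \<longrightarrow> (a, b, d) \<in> C) \<and>
     (\<forall>a\<in>G. \<forall>b\<in>G. \<forall>c\<in>G. a \<noteq> b \<and> b \<noteq> c \<and> a \<noteq> c \<longrightarrow>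
        (a, b, c) \<in> C \<or> (c, b, a) \<in> C)"

definition additive_cyclic_order :: "('a::ab_group_add \<times> 'a \<times> 'a) set \<Rightarrow> bool" where
  "additive_cyclic_order C \<longleftrightarrow>
     cyclic_order_on UNIV C \<and>
     (\<forall>a b c d. (a, b, c) \<in> C \<longrightarrow> (a + d, b + d, c + d) \<in> C)"

datatype cyc_term =
    Var nat
  | Plus cyc_term cyc_term

datatype cyc_form =
    Equal cyc_term cyc_term
  | Cyc cyc_term cyc_term cyc_term
  | Neg cyc_form
  | Conj cyc_form cyc_form
  | Exists nat cyc_form

primrec term_vars :: "cyc_term \<Rightarrow> nat set" where
  "term_vars (Var n) = {n}"
| "term_vars (Plus s t) = term_vars s \<union> term_vars t"

primrec free_vars :: "cyc_form \<Rightarrow> nat set" where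
  "free_vars (Equal s t) = term_vars s \<union> term_vars t"
| "free_vars (Cyc s t u) = term_vars s \<union> term_vars t \<union> term_vars u"
| "free_vars (Neg \<phi>) = free_vars \<phi>"
| "free_vars (Conj \<phi> \<psi>) = free_vars \<phi> \<union> free_vars \<psi>"
| "free_vars (Exists n \<phi>) = free_vars \<phi> - {n}"

record 'a cyc_structure =
  universe :: "'a set"
  plus_of :: "'a \<Rightarrow> 'a \<Rightarrow> 'a"
  cyc_of :: "('a \<times> 'a \<times> 'a) set"

definition is_cyc_structure :: "'a cyc_structure \<Rightarrow> bool" where
  "is_cyc_structure M \<longleftrightarrow>
     universe M \<noteq> {} \<and>
     (\<forall>a\<in>universe M. \<forall>b\<in>universe M. plus_of M a b \<in> universe M) \<and>
     cyc_of M \<subseteq> universe M \<times> universe M \<times> universe M"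

primrec term_value :: "'a cyc_structure \<Rightarrow> (nat \<Rightarrow> 'a) \<Rightarrow> cyc_term \<Rightarrow> 'a" where
  "term_value M v (Var n) = v n"
| "term_value M v (Plus s t) = plus_of M (term_value M v s) (term_value M v t)"

primrec satisfies :: "'a cyc_structure \<Rightarrow> (nat \<Rightarrow> 'a) \<Rightarrow> cyc_form \<Rightarrow> bool" where
  "satisfies M v (Equal s t) \<longleftrightarrow> term_value M v s = term_value M v t"
| "satisfies M v (Cyc s t u) \<longleftrightarrow>
     (term_value M v s, term_value M v t, term_value M v u) \<in> cyc_of M"
| "satisfies M v (Neg \<phi>) \<longleftrightarrow> \<not> satisfies M v \<phi>"
| "satisfies M v (Conj \<phi> \<psi>) \<longleftrightarrow> satisfies M v \<phi> \<and> satisfies M v \<psi>"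
| "satisfies M v (Exists n \<phi>) \<longleftrightarrow> (\<exists>a\<in>universe M. satisfies M (v(n := a)) \<phi>)"

definition elementary_embedding ::
    "'a cyc_structure \<Rightarrow> 'b cyc_structure \<Rightarrow> ('a \<Rightarrow> 'b) \<Rightarrow> bool" where
  "elementary_embedding M N e \<longleftrightarrow>
     e ` universe M \<subseteq> universe N \<and>
     (\<forall>\<phi> v. range v \<subseteq> universe M \<longrightarrow> (satisfies M v \<phi> \<longleftrightarrow> satisfies N (e \<circ> v) \<phi>))"

text \<open>
  A formula \<open>\<phi>(x; y\<^sub>1, \<dots>, y\<^sub>n)\<close> is one whose free variables are among \<open>0, \<dots>, n\<close>;
  the variable \<open>0\<close> plays the role of \<open>x\<close> and the variable \<open>k\<close> that of \<open>y\<^sub>k\<close>.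
  The pair \<open>(\<phi>, a)\<close> with \<open>length a = n\<close> stands for the formula \<open>\<phi>(x; a)\<close> with parameters.
\<close>

definition is_partitioned :: "cyc_form \<Rightarrow> nat \<Rightarrow> bool" where
  "is_partitioned \<phi> n \<longleftrightarrow> free_vars \<phi> \<subseteq> {0..n}"

definition holds_at :: "'a cyc_structure \<Rightarrow> 'a \<Rightarrow> cyc_form \<Rightarrow> 'a list \<Rightarrow> bool" where
  "holds_at M x \<phi> a \<longleftrightarrow> satisfies M (\<lambda>k. if k = 0 then x else a ! (k - 1)) \<phi>"

text \<open>
  A set of formulas in the single variable \<open>x\<close> with parameters in \<open>N\<close> is consistent (with the
  elementary diagram of \<open>N\<close>) if it is realised in an elementary extension of \<open>N\<close>. Extensions are
  taken up to isomorphism, that is, as elementary embeddings. Here the extension has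
  its universe in the same type as \<open>N\<close>, see the remark on \<open>dp_minimal\<close> below.
\<close>

definition consistent_over ::
    "'u cyc_structure \<Rightarrow> (cyc_form \<times> 'u list) set \<Rightarrow> bool" where
  "consistent_over N \<Gamma> \<longleftrightarrow>
     (\<exists>(N' :: 'u cyc_structure) e.
        is_cyc_structure N' \<and> elementary_embedding N N' e \<and>
        (\<exists>x\<in>universe N'. \<forall>(\<theta>, c)\<in>\<Gamma>. holds_at N' x \<theta> (map e c)))"

definition ict_pattern_in ::
    "'u cyc_structure \<Rightarrow> cyc_form \<Rightarrow> cyc_form \<Rightarrow> (nat \<Rightarrow> 'u list) \<Rightarrow> (nat \<Rightarrow> 'u list) \<Rightarrow> bool" where
  "ict_pattern_in N \<phi> \<psi> a b \<longleftrightarrow>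
     (\<exists>m. is_partitioned \<phi> m \<and> (\<forall>i. length (a i) = m \<and> set (a i) \<subseteq> universe N)) \<and>
     (\<exists>n. is_partitioned \<psi> n \<and> (\<forall>j. length (b j) = n \<and> set (b j) \<subseteq> universe N)) \<and>
     (\<forall>i j. consistent_over N
        ({(\<phi>, a i), (\<psi>, b j)}
           \<union> {(Neg \<phi>, a i') | i'. i' \<noteq> i}
           \<union> {(Neg \<psi>, b j') | j'. j' \<noteq> j}))"

text \<open>
  HOL cannot quantify over types inside a definition, so the type \<open>'u\<close> in which the elementary
  extensions live is a parameter. Dp-minimality of \<open>M\<close> is \<open>dp_minimal TYPE('u) M\<close> for all
  types \<open>'u\<close>, i.e. with \<open>'u\<close> left as a type variable. One type for both kinds of extensions
  suffices: universes are sets, so any family of structures can be copied into one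
  sufficiently large type.
\<close>

definition dp_minimal :: "'u itself \<Rightarrow> 'a cyc_structure \<Rightarrow> bool" where
  "dp_minimal _ M \<longleftrightarrow>
     \<not> (\<exists>(N :: 'u cyc_structure) e \<phi> \<psi> a b.
          is_cyc_structure N \<and> elementary_embedding M N e \<and> ict_pattern_in N \<phi> \<psi> a b)"

definition group_structure :: "('a::ab_group_add \<times> 'a \<times> 'a) set \<Rightarrow> 'a cyc_structure" where
  "group_structure C = \<lparr>universe = UNIV, plus_of = (+), cyc_of = C\<rparr>"

end

theory Submission
  imports Defs "HOL-Library.Nat_Bijection" "HOL-Analysis.Kronecker_Approximation_Theorem"
begin

text \<open>
  An ict-pattern of depth two contains, for every \<open>n\<close>, a finite \<open>n \<times> n\<close> grid whose existence is
  expressed by a single first-order sentence. Such a sentence is reflected along elementary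
  embeddings, so \<open>\<int>\<close> itself contains arbitrarily large grids
  (\<open>ict_pattern_realised_finitely\<close>). It therefore suffices to understand definable sets in the
  one concrete structure \<open>(\<int>; +, C)\<close>, uniformly in the parameters.

  Every additive cyclic order on \<open>\<int>\<close> has a rotation number \<open>\<alpha>\<close>. The function that counts
  how often \<open>0, a, a + b\<close> winds around the circle is a two-cocycle on \<open>\<int>\<close>, hence the coboundary
  of some \<open>w\<close>, and \<open>w\<close> differs from \<open>n \<mapsto> n\<alpha>\<close> by at most \<open>1\<close>. If \<open>\<alpha>\<close> is irrational, then
  \<open>w n = \<lfloor>n\<alpha>\<rfloor>\<close> and \<open>C\<close> is the order pulled back from the circle along \<open>n \<mapsto> n\<alpha>\<close> modulo \<open>1\<close>. If
  \<open>\<alpha>\<close> is rational with denominator \<open>q\<close>, then \<open>w n - n\<alpha>\<close> depends only on \<open>n\<close> modulo \<open>q\<close> and on the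
  sign of \<open>n\<close>, so that \<open>C\<close> is definable in Presburger arithmetic. In both cases there is an injection
  \<open>f\<close> of \<open>\<int>\<close> into the reals (the fractional part of \<open>n\<alpha>\<close>, or the inclusion) such that
  membership in \<open>C\<close> is decided by the \<open>f\<close>-order of the three points and by their residues.

  In place of quantifier elimination there is a back-and-forth argument. Two assignments are similar
  if the signs of all linear forms with bounded integer coefficients in the values of \<open>f\<close> agree, and
  if certain residues agree. Given similar \<open>v\<close>, \<open>w\<close> and a new point \<open>a\<close>, a matching point \<open>b\<close>
  exists: if \<open>a\<close> lies on one of the finitely many cuts given by \<open>v\<close>, it is determined by a linear
  equation that the residues make solvable for \<open>w\<close>; otherwise \<open>b\<close> is chosen in the corresponding open
  gap, which meets every residue class by Kronecker's density theorem in the irrational case and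
  because it is long in the rational case. Hence each formula is invariant under similarity for
  suitable bounds (\<open>formulas_sim_invariant\<close>).

  Consequently, inside one residue class, the truth value of \<open>\<phi>(x; a)\<close> is a function of
  boundedly many signs that are monotone in \<open>f x\<close>. On an \<open>n \<times> n\<close> grid the sum of all these signs
  over the \<open>2n\<close> parameters is monotone in \<open>f x\<close> and must change between any two grid points of the
  same residue class. It takes only \<open>O(n)\<close> values, which is incompatible with \<open>n\<^sup>2\<close> grid points
  (\<open>sim_invariant_imp_no_large_pattern\<close>).
\<close>

section \<open>Finite patterns in the small structure\<close>

lemma term_value_cong:
  "(\<And>k. k \<in> term_vars t \<Longrightarrow> v k = w k) \<Longrightarrow> term_value M v t = term_value M w t"
  by (induction t) auto

lemma satisfies_cong:
  "(\<And>k. k \<in> free_vars \<phi> \<Longrightarrow> v k = w k) \<Longrightarrow> satisfies M v \<phi> \<longleftrightarrow> satisfies M w \<phi>"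
proof (induction \<phi> arbitrary: v w)
  case (Equal s t)
  then show ?case using term_value_cong[of s v w M] term_value_cong[of t v w M] by simp
next
  case (Cyc s t u)
  then show ?case
    using term_value_cong[of s v w M] term_value_cong[of t v w M] term_value_cong[of u v w M] by simp
next
  case (Conj \<phi> \<psi>)
  have "satisfies M v \<phi> \<longleftrightarrow> satisfies M w \<phi>" "satisfies M v \<psi> \<longleftrightarrow> satisfies M w \<psi>"
    by (rule Conj.IH; simp add: Conj.prems)+
  then show ?case by simp
next
  case (Exists n \<phi>)
  have "satisfies M (v(n := a)) \<phi> \<longleftrightarrow> satisfies M (w(n := a)) \<phi>" for a
    by (rule Exists.IH) (use Exists.prems in auto)
  then show ?case by simp
next
  case (Neg \<phi>)
  have "satisfies M v \<phi> \<longleftrightarrow> satisfies M w \<phi>"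
    by (rule Neg.IH) (use Neg.prems in auto)
  then show ?case by simp
qed

text \<open>
  Bound variables are renamed as well, so that an injective renaming never captures a variable and
  no side condition on \<open>\<phi>\<close> is needed.
\<close>

primrec rename_term :: "(nat \<Rightarrow> nat) \<Rightarrow> cyc_term \<Rightarrow> cyc_term" where
  "rename_term h (Var n) = Var (h n)"
| "rename_term h (Plus s t) = Plus (rename_term h s) (rename_term h t)"

primrec rename :: "(nat \<Rightarrow> nat) \<Rightarrow> cyc_form \<Rightarrow> cyc_form" where
  "rename h (Equal s t) = Equal (rename_term h s) (rename_term h t)"
| "rename h (Cyc s t u) = Cyc (rename_term h s) (rename_term h t) (rename_term h u)"
| "rename h (Neg \<phi>) = Neg (rename h \<phi>)"
| "rename h (Conj \<phi> \<psi>) = Conj (rename h \<phi>) (rename h \<psi>)"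
| "rename h (Exists n \<phi>) = Exists (h n) (rename h \<phi>)"

lemma term_value_rename: "term_value M v (rename_term h t) = term_value M (v \<circ> h) t"
  by (induction t) auto

lemma satisfies_rename:
  assumes "inj h"
  shows "satisfies M v (rename h \<phi>) \<longleftrightarrow> satisfies M (v \<circ> h) \<phi>"
proof (induction \<phi> arbitrary: v)
  case (Exists n \<phi>)
  have "v(h n := a) \<circ> h = (v \<circ> h)(n := a)" for a
    using assms by (auto simp: fun_eq_iff inj_eq)
  then show ?case by (simp only: rename.simps satisfies.simps Exists.IH)
qed (auto simp: term_value_rename)

lemma finite_free_vars: "finite (free_vars \<phi>)"
proof -
  have "finite (term_vars t)" for t by (induction t) auto
  then show ?thesis by (induction \<phi>) auto
qed

primrec conjs :: "cyc_form list \<Rightarrow> cyc_form" where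
  "conjs [] = Equal (Var 0) (Var 0)"
| "conjs (\<phi> # \<phi>s) = Conj \<phi> (conjs \<phi>s)"

lemma satisfies_conjs: "satisfies M v (conjs \<phi>s) \<longleftrightarrow> (\<forall>\<phi>\<in>set \<phi>s. satisfies M v \<phi>)"
  by (induction \<phi>s) auto

primrec exs :: "nat list \<Rightarrow> cyc_form \<Rightarrow> cyc_form" where
  "exs [] \<phi> = \<phi>"
| "exs (k # ks) \<phi> = Exists k (exs ks \<phi>)"

lemma satisfies_exsI:
  assumes "\<And>k. u k \<in> universe M"
    and "satisfies M (\<lambda>k. if k \<in> set ks then u k else v k) \<phi>"
  shows "satisfies M v (exs ks \<phi>)"
  using assms(2)
proof (induction ks arbitrary: v)
  case (Cons k ks)
  have "(\<lambda>j. if j \<in> set ks then u j else (v(k := u k)) j)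
      = (\<lambda>j. if j \<in> set (k # ks) then u j else v j)"
    by (auto simp: fun_eq_iff)
  then have "satisfies M (v(k := u k)) (exs ks \<phi>)"
    using Cons.IH[of "v(k := u k)"] Cons.prems by (simp only:)
  then show ?case using assms(1) by auto
qed simp

lemma satisfies_exsD:
  assumes "satisfies M v (exs ks \<phi>)" "range v \<subseteq> universe M"
  shows "\<exists>u. range u \<subseteq> universe M \<and> satisfies M u \<phi>"
  using assms
proof (induction ks arbitrary: v)
  case (Cons k ks)
  then obtain a where a: "a \<in> universe M" "satisfies M (v(k := a)) (exs ks \<phi>)" by auto
  have "range (v(k := a)) \<subseteq> universe M" using a(1) Cons.prems(2) by auto
  then show ?case using Cons.IH a(2) by blast
next
  case Nil
  then show ?case by (intro exI[of _ v]) simp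
qed

text \<open>
  The existential closure of \<open>\<phi>\<close> is a sentence; being true in \<open>N\<close>, it is true in \<open>M\<close>.
\<close>

lemma elementary_embedding_reflects_realisable:
  assumes "elementary_embedding M N e" "universe M \<noteq> {}"
    and "range u \<subseteq> universe N" "satisfies N u \<phi>"
  shows "\<exists>v. range v \<subseteq> universe M \<and> satisfies M v \<phi>"
proof -
  obtain m where m: "m \<in> universe M" using assms(2) by auto
  define ks where "ks = sorted_list_of_set (free_vars \<phi>)"
  have ks: "set ks = free_vars \<phi>" by (simp add: ks_def finite_free_vars)
  let ?v = "\<lambda>_ :: nat. m"
  have "satisfies N (\<lambda>k. if k \<in> set ks then u k else (e \<circ> ?v) k) \<phi>"
    using assms(4) satisfies_cong[of \<phi> u "\<lambda>k. if k \<in> set ks then u k else (e \<circ> ?v) k" N] ks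
    by simp
  then have "satisfies N (e \<circ> ?v) (exs ks \<phi>)"
    using assms(3) by (intro satisfies_exsI[of u]) auto
  then have "satisfies M ?v (exs ks \<phi>)"
    using assms(1) m unfolding elementary_embedding_def by (auto simp: image_subset_iff)
  then show ?thesis using satisfies_exsD[of M ?v ks \<phi>] m by auto
qed

text \<open>
  The variables of the \<open>s\<close>-th copy of a formula. All copies share the object variable \<open>0\<close>, and
  the parameter variables of different copies are disjoint.
\<close>

definition private_var :: "nat \<Rightarrow> nat \<Rightarrow> nat" where
  "private_var s k = (if k = 0 then 0 else Suc (prod_encode (s, k)))"

lemma inj_private_var: "inj (private_var s)"
  by (auto simp: inj_def private_var_def split: if_splits)

lemma fun_upd_private_var: "v(0 := x) \<circ> private_var s = (v \<circ> private_var s)(0 := x)"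
  by (auto simp: fun_eq_iff private_var_def)

text \<open>
  The existence of a finite grid is one sentence: with disjoint parameter variables for the rows
  and columns, it is the conjunction over all cells of the formula saying that some \<open>x\<close> lies in exactly
  that row and that column. The extension realising a single cell shows that this cell's formula holds in
  \<open>N\<close>, and the parameters of \<open>N\<close> can then be replaced by elements of \<open>M\<close>.
\<close>

lemma ict_pattern_realised_finitely:
  fixes M :: "'a cyc_structure" and N :: "'u cyc_structure" and n :: nat
  assumes el: "elementary_embedding M N e" and ne: "universe M \<noteq> {}"
    and pat: "ict_pattern_in N \<phi> \<psi> a b"
  shows "\<exists>p q x. \<forall>i<n. \<forall>j<n. x i j \<in> universe M \<and>
           (\<forall>i'<n. satisfies M ((p i')(0 := x i j)) \<phi> \<longleftrightarrow> i' = i) \<and>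
           (\<forall>j'<n. satisfies M ((q j')(0 := x i j)) \<psi> \<longleftrightarrow> j' = j)"
proof -
  from pat obtain l where l: "is_partitioned \<phi> l" "\<And>i. length (a i) = l" "\<And>i. set (a i) \<subseteq> universe N"
    unfolding ict_pattern_in_def by auto
  from pat obtain r where r: "is_partitioned \<psi> r" "\<And>j. length (b j) = r" "\<And>j. set (b j) \<subseteq> universe N"
    unfolding ict_pattern_in_def by auto
  obtain d where d: "d \<in> universe N" using el ne unfolding elementary_embedding_def by blast
  \<comment> \<open>even indices code rows, odd indices columns\<close>
  define par where "par s = (if even s then a (s div 2) else b (s div 2))" for s :: nat
  \<comment> \<open>the default \<open>d\<close> keeps every value of the assignment in the universe\<close>
  define u where "u y = (case y of 0 \<Rightarrow> d | Suc c \<Rightarrow> (case prod_decode c of (s, k) \<Rightarrow>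
      if k - 1 < length (par s) then par s ! (k - 1) else d))" for y
  have u: "range u \<subseteq> universe N"
  proof -
    have "set (par s) \<subseteq> universe N" for s unfolding par_def using l(3) r(3) by simp
    then have "par s ! k \<in> universe N" if "k < length (par s)" for s k using that nth_mem by blast
    then show ?thesis unfolding u_def using d by (auto split: nat.split prod.split)
  qed
  have u_eq: "u (private_var s k) = par s ! (k - 1)" if "1 \<le> k" "k \<le> length (par s)" for s k
    unfolding u_def private_var_def using that by auto
  have holds: "satisfies N' ((e' \<circ> u)(0 := x)) (rename (private_var s) \<theta>) \<longleftrightarrow> holds_at N' x \<theta> (map e' (par s))"
    if "is_partitioned \<theta> (length (par s))" for N' :: "'u cyc_structure" and e' x s \<theta>
    unfolding satisfies_rename[OF inj_private_var] holds_at_def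
  proof (rule satisfies_cong)
    fix k assume "k \<in> free_vars \<theta>"
    then have "k \<le> length (par s)" using that unfolding is_partitioned_def by auto
    then show "((e' \<circ> u)(0 := x) \<circ> private_var s) k = (if k = 0 then x else map e' (par s) ! (k - 1))"
      using u_eq[of k s] by (auto simp: private_var_def)
  qed
  have par: "par (2 * i) = a i" "par (Suc (2 * i)) = b i" for i unfolding par_def by auto
  define row where "row i = rename (private_var (2 * i)) \<phi>" for i
  define col where "col j = rename (private_var (Suc (2 * j))) \<psi>" for j
  define cell where "cell i j = Exists 0 (conjs (
      map (\<lambda>i'. if i' = i then row i' else Neg (row i')) [0..<n] @
      map (\<lambda>j'. if j' = j then col j' else Neg (col j')) [0..<n]))" for i j
  have cell: "satisfies M' v (cell i j) \<longleftrightarrow> (\<exists>x\<in>universe M'.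
      (\<forall>i'<n. satisfies M' (v(0 := x)) (row i') \<longleftrightarrow> i' = i) \<and>
      (\<forall>j'<n. satisfies M' (v(0 := x)) (col j') \<longleftrightarrow> j' = j))" for i j v and M' :: "'x cyc_structure"
  proof -
    have "satisfies M' w (if k = l then \<theta> else Neg \<theta>) \<longleftrightarrow> (satisfies M' w \<theta> \<longleftrightarrow> k = l)" for k l :: nat and w \<theta>
      by simp
    then show ?thesis
      unfolding cell_def by (simp only: satisfies.simps satisfies_conjs set_append set_map ball_Un
          ball_simps set_upt atLeast0LessThan lessThan_iff) blast
  qed
  have "satisfies N u (cell i j)" for i j
  proof -
    have "consistent_over N ({(\<phi>, a i), (\<psi>, b j)}
           \<union> {(Neg \<phi>, a i') | i'. i' \<noteq> i} \<union> {(Neg \<psi>, b j') | j'. j' \<noteq> j})"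
      using pat unfolding ict_pattern_in_def by blast
    then obtain N' :: "'u cyc_structure" and e' x where N': "elementary_embedding N N' e'" "x \<in> universe N'"
      and x: "\<forall>(\<theta>, c)\<in>{(\<phi>, a i), (\<psi>, b j)} \<union> {(Neg \<phi>, a i') | i'. i' \<noteq> i}
               \<union> {(Neg \<psi>, b j') | j'. j' \<noteq> j}. holds_at N' x \<theta> (map e' c)"
      unfolding consistent_over_def by blast
    have neg: "holds_at N' x (Neg \<theta>) c \<longleftrightarrow> \<not> holds_at N' x \<theta> c" for \<theta> c
      by (simp add: holds_at_def)
    have "holds_at N' x \<phi> (map e' (a i')) \<longleftrightarrow> i' = i" for i'
      using x neg bspec[OF x, of "(Neg \<phi>, a i')"] by (cases "i' = i") auto
    moreover have "holds_at N' x \<psi> (map e' (b j')) \<longleftrightarrow> j' = j" for j'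
      using x neg bspec[OF x, of "(Neg \<psi>, b j')"] by (cases "j' = j") auto
    moreover have "satisfies N' ((e' \<circ> u)(0 := x)) (row i') \<longleftrightarrow> holds_at N' x \<phi> (map e' (a i'))" for i'
      unfolding row_def using holds[of \<phi> "2 * i'" N' e' x] l(1,2) by (simp only: par)
    moreover have "satisfies N' ((e' \<circ> u)(0 := x)) (col j') \<longleftrightarrow> holds_at N' x \<psi> (map e' (b j'))" for j'
      unfolding col_def using holds[of \<psi> "Suc (2 * j')" N' e' x] r(1,2) by (simp only: par)
    ultimately have "satisfies N' (e' \<circ> u) (cell i j)"
      unfolding cell using N'(2) by blast
    then show ?thesis using N'(1) u unfolding elementary_embedding_def by blast
  qed
  then have "satisfies N u (conjs (map (\<lambda>(i, j). cell i j) (List.product [0..<n] [0..<n])))"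
    by (auto simp: satisfies_conjs)
  then obtain v where v: "satisfies M v (conjs (map (\<lambda>(i, j). cell i j) (List.product [0..<n] [0..<n])))"
    using elementary_embedding_reflects_realisable[OF el ne u] by blast
  then have cells: "satisfies M v (cell i j)" if "i < n" "j < n" for i j
    using that by (auto simp: satisfies_conjs)
  define good where "good i j x \<longleftrightarrow> x \<in> universe M \<and>
      (\<forall>i'<n. satisfies M (v(0 := x)) (row i') \<longleftrightarrow> i' = i) \<and>
      (\<forall>j'<n. satisfies M (v(0 := x)) (col j') \<longleftrightarrow> j' = j)" for i j x
  define x where "x i j = (SOME x. good i j x)" for i j
  have "good i j (x i j)" if "i < n" "j < n" for i j
  proof -
    have "\<exists>x. good i j x"
      using cells[OF that] unfolding cell good_def by (simp only: Bex_def)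
    then show ?thesis unfolding x_def by (rule someI_ex)
  qed
  then show ?thesis
    unfolding good_def row_def col_def satisfies_rename[OF inj_private_var] fun_upd_private_var
    by (intro exI[of _ "\<lambda>i. v \<circ> private_var (2 * i)"] exI[of _ "\<lambda>j. v \<circ> private_var (Suc (2 * j))"]
        exI[of _ x] allI impI)
qed

section \<open>Similar assignments and the counting argument\<close>

text \<open>
  Coefficients vanish outside \<open>V\<close>, which makes the set finite.
\<close>

definition coeffs :: "nat set \<Rightarrow> int \<Rightarrow> (nat \<Rightarrow> int) set" where
  "coeffs V B = {c. (\<forall>i\<in>V. \<bar>c i\<bar> \<le> B) \<and> (\<forall>i. i \<notin> V \<longrightarrow> c i = 0)}"

definition lin :: "(int \<Rightarrow> real) \<Rightarrow> nat set \<Rightarrow> (nat \<Rightarrow> int) \<Rightarrow> int \<Rightarrow> (nat \<Rightarrow> int) \<Rightarrow> real" where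
  "lin f V c c0 v = (\<Sum>i\<in>V. of_int (c i) * f (v i)) + of_int c0"

text \<open>
  The relation for the back-and-forth argument. In the application \<open>f\<close> embeds \<open>\<int>\<close> into an ordered
  group \<open>H\<close> of reals that contains \<open>1\<close>: either \<open>H = \<int>\<close> with \<open>f n = n\<close> and \<open>g n = 0\<close>, or \<open>H = \<int> + \<int>\<alpha>\<close> with
  \<open>f n = n\<alpha> - g n\<close> and \<open>g n = \<lfloor>n\<alpha>\<rfloor>\<close>. The residues of \<open>n\<close> and of \<open>g n\<close> modulo \<open>M\<close> determine the coset
  of \<open>f n\<close> modulo \<open>M H\<close>, which is what division in \<open>H\<close> requires.
\<close>

definition sim :: "(int \<Rightarrow> real) \<Rightarrow> (int \<Rightarrow> int) \<Rightarrow> nat set \<Rightarrow> int \<Rightarrow> int \<Rightarrow> (nat \<Rightarrow> int) \<Rightarrow> (nat \<Rightarrow> int) \<Rightarrow> bool" where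
  "sim f g V B M v w \<longleftrightarrow>
     (\<forall>c\<in>coeffs V B. \<forall>c0\<in>{-B..B}. sgn (lin f V c c0 v) = sgn (lin f V c c0 w)) \<and>
     (\<forall>i\<in>V. v i mod M = w i mod M \<and> g (v i) mod M = g (w i) mod M)"

lemma finite_coeffs: "finite V \<Longrightarrow> finite (coeffs V B)"
  using finite_set_of_finite_funs[of V "{-B..B}" 0]
  by (rule back_subst[of finite]) (auto simp: coeffs_def abs_le_iff)

lemma lin_diff: "lin f V c c0 v - lin f V d d0 v = lin f V (\<lambda>i. c i - d i) (c0 - d0) v"
  by (simp add: lin_def sum_subtractf left_diff_distrib)

lemma lin_scale: "of_int n * lin f V c c0 v = lin f V (\<lambda>i. n * c i) (n * c0) v"
  by (simp add: lin_def sum_distrib_left distrib_left mult.assoc)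

text \<open>
  Replacing the value of one variable isolates its contribution; the remaining form is again one in the
  old values, with coefficient \<open>0\<close> at \<open>k\<close>.
\<close>

lemma lin_fun_upd:
  assumes "finite V" "k \<in> V"
  shows "lin f V c c0 (v(k := a)) = of_int (c k) * f a + lin f V (c(k := 0)) c0 v"
  using assms by (simp add: lin_def sum.remove[of V k])

lemma coeffs_diff: "c \<in> coeffs V B \<Longrightarrow> d \<in> coeffs V E \<Longrightarrow> (\<lambda>i. c i - d i) \<in> coeffs V (B + E)"
  unfolding coeffs_def by (fastforce intro: order_trans[OF abs_triangle_ineq4])

lemma coeffs_scale: "c \<in> coeffs V B \<Longrightarrow> \<bar>n\<bar> \<le> N \<Longrightarrow> (\<lambda>i. n * c i) \<in> coeffs V (N * B)"
  unfolding coeffs_def by (auto simp: abs_mult intro!: mult_mono)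

lemma coeffs_mono: "c \<in> coeffs V B \<Longrightarrow> B \<le> E \<Longrightarrow> c \<in> coeffs V E"
  unfolding coeffs_def by fastforce

lemma coeffs_fun_upd: "c \<in> coeffs V B \<Longrightarrow> 0 \<le> B \<Longrightarrow> c(k := 0) \<in> coeffs V B"
  unfolding coeffs_def by auto

lemma zero_in_coeffs: "0 \<le> B \<Longrightarrow> (\<lambda>_. 0) \<in> coeffs V B"
  by (simp add: coeffs_def)

lemma sim_sgn: "sim f g V B M v w \<Longrightarrow> c \<in> coeffs V B \<Longrightarrow> \<bar>c0\<bar> \<le> B \<Longrightarrow> sgn (lin f V c c0 v) = sgn (lin f V c c0 w)"
  unfolding sim_def by (simp add: abs_le_iff)

lemma sim_mod: "sim f g V B M v w \<Longrightarrow> i \<in> V \<Longrightarrow> v i mod M = w i mod M"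
  and sim_mod': "sim f g V B M v w \<Longrightarrow> i \<in> V \<Longrightarrow> g (v i) mod M = g (w i) mod M"
  unfolding sim_def by simp_all

lemma sim_sym: "sim f g V B M v w \<Longrightarrow> sim f g V B M w v"
  unfolding sim_def by simp

lemma mod_eq_mono: "n dvd m \<Longrightarrow> (a :: int) mod m = b mod m \<Longrightarrow> a mod n = b mod n"
  by (metis mod_mod_cancel)

lemma sim_mono:
  assumes "sim f g V B' M' v w" "B \<le> B'" "M dvd M'"
  shows "sim f g V B M v w"
  unfolding sim_def
proof (intro conjI ballI)
  fix c c0 assume "c \<in> coeffs V B" "c0 \<in> {-B..B}"
  then show "sgn (lin f V c c0 v) = sgn (lin f V c c0 w)"
    using assms(1,2) by (intro sim_sgn[OF assms(1)]) (auto intro: coeffs_mono)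
qed (use assms sim_mod sim_mod' mod_eq_mono in blast)+

primrec all_vars :: "cyc_form \<Rightarrow> nat set" where
  "all_vars (Equal s t) = term_vars s \<union> term_vars t"
| "all_vars (Cyc s t u) = term_vars s \<union> term_vars t \<union> term_vars u"
| "all_vars (Neg \<phi>) = all_vars \<phi>"
| "all_vars (Conj \<phi> \<psi>) = all_vars \<phi> \<union> all_vars \<psi>"
| "all_vars (Exists n \<phi>) = insert n (all_vars \<phi>)"

lemma finite_all_vars: "finite (all_vars \<phi>)"
proof -
  have "finite (term_vars t)" for t by (induction t) auto
  then show ?thesis by (induction \<phi>) auto
qed

text \<open>
  One implication suffices because similarity is symmetric. Asking for positive bounds makes them
  combine by maximum and product.
\<close>

definition sim_invariant where
  "sim_invariant f g V P \<longleftrightarrow> (\<exists>B\<ge>1. \<exists>M\<ge>1. \<forall>v w. sim f g V B M v w \<longrightarrow> P v \<longrightarrow> P w)"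

lemma sim_invariantI:
  assumes "1 \<le> B" "1 \<le> M" "\<And>v w. sim f g V B M v w \<Longrightarrow> P v \<Longrightarrow> P w"
  shows "sim_invariant f g V P"
  using assms unfolding sim_invariant_def by blast

lemma sim_invariant_conj:
  assumes "sim_invariant f g V P" "sim_invariant f g V Q"
  shows "sim_invariant f g V (\<lambda>v. P v \<and> Q v)"
proof -
  obtain B M where P: "1 \<le> B" "1 \<le> M" "\<And>v w. sim f g V B M v w \<Longrightarrow> P v \<Longrightarrow> P w"
    using assms(1) unfolding sim_invariant_def by blast
  obtain B' M' where Q: "1 \<le> B'" "1 \<le> M'" "\<And>v w. sim f g V B' M' v w \<Longrightarrow> Q v \<Longrightarrow> Q w"
    using assms(2) unfolding sim_invariant_def by blast
  show ?thesis
  proof (rule sim_invariantI[of "max B B'" "M * M'"])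
    show "1 \<le> max B B'" using P(1) by simp
    show "1 \<le> M * M'" using mult_mono[of 1 M 1 M'] P(2) Q(2) by simp
    fix v w assume "sim f g V (max B B') (M * M') v w"
    then have "sim f g V B M v w" "sim f g V B' M' v w" by (auto intro: sim_mono)
    then show "P v \<and> Q v \<Longrightarrow> P w \<and> Q w" using P(3) Q(3) by blast
  qed
qed

lemma sim_invariant_not: "sim_invariant f g V P \<Longrightarrow> sim_invariant f g V (\<lambda>v. \<not> P v)"
  unfolding sim_invariant_def using sim_sym by metis

definition back_and_forth where
  "back_and_forth f g \<longleftrightarrow> (\<forall>V k B M. finite V \<longrightarrow> k \<in> V \<longrightarrow> 1 \<le> B \<longrightarrow> 1 \<le> M \<longrightarrow>
     (\<exists>B'\<ge>1. \<exists>M'\<ge>1. \<forall>v w a. sim f g V B' M' v w \<longrightarrow> (\<exists>b. sim f g V B M (v(k := a)) (w(k := b)))))"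

lemma sim_invariant_ex:
  assumes "back_and_forth f g" "finite V" "k \<in> V" "sim_invariant f g V P"
  shows "sim_invariant f g V (\<lambda>v. \<exists>a. P (v(k := a)))"
proof -
  obtain B M where P: "1 \<le> B" "1 \<le> M" "\<And>v w. sim f g V B M v w \<Longrightarrow> P v \<Longrightarrow> P w"
    using assms(4) unfolding sim_invariant_def by blast
  obtain B' M' where B': "1 \<le> B'" "1 \<le> M'"
      "\<And>v w a. sim f g V B' M' v w \<Longrightarrow> \<exists>b. sim f g V B M (v(k := a)) (w(k := b))"
    using assms(1)[unfolded back_and_forth_def, rule_format, OF assms(2,3) P(1,2)] by auto
  show ?thesis by (rule sim_invariantI[OF B'(1,2)]) (use P(3) B'(3) in blast)
qed

text \<open>
  Boolean combinations only need larger bounds; a quantifier costs one back-and-forth step.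
\<close>

lemma formulas_sim_invariant:
  assumes bf: "back_and_forth f g" and V: "finite V"
    and eq: "\<And>s t. term_vars s \<union> term_vars t \<subseteq> V \<Longrightarrow>
      sim_invariant f g V (\<lambda>v. satisfies (group_structure C) v (Equal s t))"
    and cyc: "\<And>s t u. term_vars s \<union> term_vars t \<union> term_vars u \<subseteq> V \<Longrightarrow>
      sim_invariant f g V (\<lambda>v. satisfies (group_structure C) v (Cyc s t u))"
  shows "all_vars \<phi> \<subseteq> V \<Longrightarrow> sim_invariant f g V (\<lambda>v. satisfies (group_structure C) v \<phi>)"
proof (induction \<phi>)
  case (Neg \<phi>)
  then show ?case by (simp add: sim_invariant_not)
next
  case (Conj \<phi> \<psi>)
  then show ?case by (simp add: sim_invariant_conj)
next
  case (Exists k \<phi>)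
  then have "sim_invariant f g V (\<lambda>v. \<exists>a. satisfies (group_structure C) (v(k := a)) \<phi>)"
    using bf V by (intro sim_invariant_ex) auto
  then show ?case by (simp add: group_structure_def)
qed (use eq cyc in \<open>auto simp del: satisfies.simps\<close>)

text \<open>
  The factor \<open>sgn (c 0)\<close> orients every sign so that it increases with \<open>f x\<close>. Forms that do not
  involve \<open>x\<close> contribute nothing.
\<close>

definition profile :: "(int \<Rightarrow> real) \<Rightarrow> nat set \<Rightarrow> int \<Rightarrow> (nat \<Rightarrow> int) \<Rightarrow> int \<Rightarrow> int" where
  "profile f V B u x =
     (\<Sum>(c, c0)\<in>coeffs V B \<times> {-B..B}. sgn (c 0) * \<lfloor>sgn (lin f V c c0 (u(0 := x)))\<rfloor>)"

lemma floor_sgn_mono: "(x :: real) \<le> y \<Longrightarrow> \<lfloor>sgn x\<rfloor> \<le> \<lfloor>sgn y\<rfloor>"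
  by (auto simp: sgn_if)

lemma floor_sgn_inject: "\<lfloor>sgn (x :: real)\<rfloor> = \<lfloor>sgn y\<rfloor> \<Longrightarrow> sgn x = sgn y"
proof -
  have "sgn z = of_int \<lfloor>sgn z\<rfloor>" for z :: real by (simp add: sgn_if)
  then show "\<lfloor>sgn x\<rfloor> = \<lfloor>sgn y\<rfloor> \<Longrightarrow> sgn x = sgn y" by metis
qed

lemma lin_mono_sgn:
  assumes "finite V" "0 \<in> V" "f x \<le> f y"
  shows "sgn (c 0) * \<lfloor>sgn (lin f V c c0 (u(0 := x)))\<rfloor> \<le> sgn (c 0) * \<lfloor>sgn (lin f V c c0 (u(0 := y)))\<rfloor>"
proof -
  consider "c 0 = 0" | "0 < c 0" | "c 0 < 0" by linarith
  then show ?thesis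
  proof cases
    case 2
    then have "lin f V c c0 (u(0 := x)) \<le> lin f V c c0 (u(0 := y))"
      using assms by (simp add: lin_fun_upd)
    then show ?thesis using 2 floor_sgn_mono by simp
  next
    case 3
    then have "lin f V c c0 (u(0 := y)) \<le> lin f V c c0 (u(0 := x))"
      using assms by (simp add: lin_fun_upd mult_left_mono_neg)
    then show ?thesis using 3 floor_sgn_mono by simp
  qed simp
qed

lemma profile_mono:
  assumes "finite V" "0 \<in> V" "f x \<le> f y"
  shows "profile f V B u x \<le> profile f V B u y"
  unfolding profile_def using lin_mono_sgn[of V f x y, OF assms] by (auto intro!: sum_mono)

text \<open>
  Each summand of the profile is monotone in \<open>f x\<close>, so equal sums force equal summands.
\<close>

lemma profile_eq_imp_sim:
  assumes V: "finite V" "0 \<in> V" and eq: "profile f V B u x = profile f V B u y" and le: "f x \<le> f y"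
    and col: "x mod M = y mod M" "g x mod M = g y mod M"
  shows "sim f g V B M (u(0 := x)) (u(0 := y))"
  unfolding sim_def
proof (intro conjI ballI)
  fix c c0 assume c: "c \<in> coeffs V B" "c0 \<in> {-B..B}"
  have "sgn (c 0) * \<lfloor>sgn (lin f V c c0 (u(0 := x)))\<rfloor> = sgn (c 0) * \<lfloor>sgn (lin f V c c0 (u(0 := y)))\<rfloor>"
    using sum_mono_inv[OF eq[unfolded profile_def], of "(c, c0)"] c V lin_mono_sgn[of V f x y, OF V le]
    by (auto simp: finite_coeffs)
  then show "sgn (lin f V c c0 (u(0 := x))) = sgn (lin f V c c0 (u(0 := y)))"
    using V floor_sgn_inject by (cases "c 0 = 0") (auto simp: lin_fun_upd sgn_0_0)
qed (use col in auto)

lemma abs_profile_le: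
  assumes "finite V"
  shows "\<bar>profile f V B u x\<bar> \<le> int (card (coeffs V B \<times> {-B..B}))"
proof -
  have "\<bar>sgn (c 0) * \<lfloor>sgn (lin f V c c0 (u(0 := x)))\<rfloor>\<bar> \<le> 1" for c c0
  proof -
    have "-1 \<le> \<lfloor>sgn z\<rfloor>" "\<lfloor>sgn z\<rfloor> \<le> 1" for z :: real
      by (simp_all add: le_floor_iff floor_le_iff sgn_if)
    then have "\<bar>\<lfloor>sgn z\<rfloor>\<bar> \<le> 1" for z :: real by (simp add: abs_le_iff minus_le_iff)
    then show ?thesis by (simp add: abs_mult sgn_if)
  qed
  then have "\<bar>profile f V B u x\<bar> \<le> (\<Sum>p\<in>coeffs V B \<times> {-B..B}. 1)"
    unfolding profile_def by (intro order_trans[OF sum_abs] sum_mono) auto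
  then show ?thesis by simp
qed

text \<open>
  Fix a common bound \<open>B\<close> and modulus \<open>M\<close> for both predicates, and let \<open>T\<close> be the sum of the profiles
  over all rows and columns. Two grid points with the same residues and the same value of \<open>T\<close> satisfy
  the same instances of \<open>P\<close> and \<open>Q\<close>, so they are in the same cell. As \<open>\<bar>T\<bar> \<le> 2nK\<close>, where \<open>K\<close> is the number
  of forms, this leaves at most \<open>M\<^sup>2 (4nK + 1)\<close> of the \<open>n\<^sup>2\<close> cells.
\<close>

lemma sim_invariant_imp_no_large_pattern:
  assumes V: "finite V" "0 \<in> V"
    and P: "sim_invariant f g V P" and Q: "sim_invariant f g V Q"
  shows "\<exists>n :: nat. \<not> (\<exists>p q x. \<forall>i<n. \<forall>j<n.
           (\<forall>i'<n. P ((p i')(0 := x i j)) \<longleftrightarrow> i' = i) \<and> (\<forall>j'<n. Q ((q j')(0 := x i j)) \<longleftrightarrow> j' = j))"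
proof -
  obtain B1 M1 where P: "1 \<le> B1" "1 \<le> M1" "\<And>v w. sim f g V B1 M1 v w \<Longrightarrow> P v \<Longrightarrow> P w"
    using P unfolding sim_invariant_def by blast
  obtain B2 M2 where Q: "1 \<le> B2" "1 \<le> M2" "\<And>v w. sim f g V B2 M2 v w \<Longrightarrow> Q v \<Longrightarrow> Q w"
    using Q unfolding sim_invariant_def by blast
  define B where "B = max B1 B2"
  define M where "M = M1 * M2"
  have M: "1 \<le> M" using mult_mono[of 1 M1 1 M2] P(2) Q(2) by (simp add: M_def)
  have P': "P v \<longleftrightarrow> P w" and Q': "Q v \<longleftrightarrow> Q w" if "sim f g V B M v w" for v w
  proof -
    have "sim f g V B1 M1 v w" "sim f g V B2 M2 v w" using that by (auto simp: B_def M_def intro: sim_mono)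
    then show "P v \<longleftrightarrow> P w" "Q v \<longleftrightarrow> Q w" using P(3) Q(3) sim_sym by blast+
  qed
  define K where "K = card (coeffs V B \<times> {-B..B})"
  \<comment> \<open>chosen such that \<open>M\<^sup>2 (4nK + 1) < n\<^sup>2\<close>\<close>
  define n where "n = Suc (nat M * nat M * (4 * K + 1))"
  show ?thesis
  proof (intro exI[of _ n] notI)
    assume "\<exists>p q x. \<forall>i<n. \<forall>j<n.
           (\<forall>i'<n. P ((p i')(0 := x i j)) \<longleftrightarrow> i' = i) \<and> (\<forall>j'<n. Q ((q j')(0 := x i j)) \<longleftrightarrow> j' = j)"
    then obtain p q x where px: "\<And>i j i'. i < n \<Longrightarrow> j < n \<Longrightarrow> i' < n \<Longrightarrow> P ((p i')(0 := x i j)) \<longleftrightarrow> i' = i"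
      and qx: "\<And>i j j'. i < n \<Longrightarrow> j < n \<Longrightarrow> j' < n \<Longrightarrow> Q ((q j')(0 := x i j)) \<longleftrightarrow> j' = j"
      by blast
    define T where "T y = (\<Sum>i<n. profile f V B (p i) y + profile f V B (q i) y)" for y
    have sim_T: "sim f g V B M ((p i)(0 := y)) ((p i)(0 := z)) \<and> sim f g V B M ((q i)(0 := y)) ((q i)(0 := z))"
      if "T y = T z" "f y \<le> f z" "y mod M = z mod M" "g y mod M = g z mod M" "i < n" for y z i
    proof -
      have le: "profile f V B u y \<le> profile f V B u z" for u using that(2) V by (rule profile_mono[rotated 2])
      then have "profile f V B (p i) y + profile f V B (q i) y = profile f V B (p i) z + profile f V B (q i) z"
        using sum_mono_inv[OF that(1)[unfolded T_def], of i] that(5) by (simp add: add_mono)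
      then have "profile f V B (p i) y = profile f V B (p i) z" "profile f V B (q i) y = profile f V B (q i) z"
        using le[of "p i"] le[of "q i"] by linarith+
      then show ?thesis using V that by (simp add: profile_eq_imp_sim)
    qed
    define S where "S = ({0..<M} \<times> {0..<M}) \<times> {-(2 * int n * int K)..2 * int n * int K}"
    define h where "h = (\<lambda>(i, j). ((x i j mod M, g (x i j) mod M), T (x i j)))"
    have same: "i = k \<and> j = l"
      if "h (i, j) = h (k, l)" "i < n" "j < n" "k < n" "l < n" "f (x i j) \<le> f (x k l)" for i j k l
    proof -
      have "sim f g V B M ((p m)(0 := x i j)) ((p m)(0 := x k l)) \<and>
            sim f g V B M ((q m)(0 := x i j)) ((q m)(0 := x k l))" if "m < n" for m
        using \<open>h (i, j) = h (k, l)\<close> by (intro sim_T) (use that \<open>f (x i j) \<le> f (x k l)\<close> in \<open>simp_all add: h_def\<close>)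
      then have "P ((p i)(0 := x k l))" "Q ((q j)(0 := x k l))"
        using P'[of "(p i)(0 := x i j)" "(p i)(0 := x k l)"] Q'[of "(q j)(0 := x i j)" "(q j)(0 := x k l)"]
          px[of i j i] qx[of i j j] that by simp_all
      then show ?thesis using px[of k l i] qx[of k l j] that by simp
    qed
    have "inj_on h ({..<n} \<times> {..<n})"
    proof (rule inj_onI; clarsimp)
      fix i j k l assume "h (i, j) = h (k, l)" "i < n" "j < n" "k < n" "l < n"
      then show "i = k \<and> j = l"
        using same[of i j k l] same[of k l i j] by (cases "f (x i j) \<le> f (x k l)") auto
    qed
    moreover have "h ` ({..<n} \<times> {..<n}) \<subseteq> S"
    proof -
      have "\<bar>T y\<bar> \<le> 2 * int n * int K" for y
      proof -
        have "\<bar>T y\<bar> \<le> (\<Sum>i<n. 2 * int K)"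
          unfolding T_def
        proof (intro order_trans[OF sum_abs] sum_mono)
          fix i
          show "\<bar>profile f V B (p i) y + profile f V B (q i) y\<bar> \<le> 2 * int K"
            using abs_profile_le[OF V(1), of f B "p i" y] abs_profile_le[OF V(1), of f B "q i" y]
            unfolding K_def[symmetric] by linarith
        qed
        then show ?thesis by (simp add: mult_ac)
      qed
      then show ?thesis using M by (auto simp: S_def h_def abs_le_iff minus_le_iff)
    qed
    ultimately have "card ({..<n} \<times> {..<n}) \<le> card S"
      by (intro card_inj_on_le[of h]) (auto simp: S_def)
    then have "n * n \<le> nat M * nat M * (4 * n * K + 1)"
      by (simp add: S_def card_cartesian_product nat_add_distrib nat_mult_distrib algebra_simps)
    also have "\<dots> \<le> nat M * nat M * (4 * n * K + n)"
      using M by (simp add: n_def)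
    also have "\<dots> = n * (nat M * nat M * (4 * K + 1))" by (simp add: algebra_simps)
    also have "\<dots> < n * n" by (simp add: n_def)
    finally show False by simp
  qed
qed

lemma dp_minimal_if_back_and_forth:
  fixes C :: "(int \<times> int \<times> int) set"
  assumes bf: "back_and_forth f g"
    and eq: "\<And>V s t. finite V \<Longrightarrow> term_vars s \<union> term_vars t \<subseteq> V \<Longrightarrow>
      sim_invariant f g V (\<lambda>v. satisfies (group_structure C) v (Equal s t))"
    and cyc: "\<And>V s t u. finite V \<Longrightarrow> term_vars s \<union> term_vars t \<union> term_vars u \<subseteq> V \<Longrightarrow>
      sim_invariant f g V (\<lambda>v. satisfies (group_structure C) v (Cyc s t u))"
  shows "dp_minimal TYPE('u) (group_structure C)"
  unfolding dp_minimal_def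
proof (intro notI; elim exE conjE)
  fix N :: "'u cyc_structure" and e \<phi> \<psi> a b
  assume el: "elementary_embedding (group_structure C) N e" and pat: "ict_pattern_in N \<phi> \<psi> a b"
  let ?M = "group_structure C"
  define V where "V = insert 0 (all_vars \<phi> \<union> all_vars \<psi>)"
  have V: "finite V" "0 \<in> V" "all_vars \<phi> \<subseteq> V" "all_vars \<psi> \<subseteq> V"
    by (auto simp: V_def finite_all_vars)
  have inv: "sim_invariant f g V (\<lambda>v. satisfies ?M v \<theta>)" if "all_vars \<theta> \<subseteq> V" for \<theta>
    using formulas_sim_invariant[OF bf V(1) eq cyc that] V(1) by blast
  have univ: "universe ?M = UNIV" by (simp add: group_structure_def)
  then have "universe ?M \<noteq> {}" by simp
  note patterns = ict_pattern_realised_finitely[OF el this pat]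
  show False
    using sim_invariant_imp_no_large_pattern[OF V(1,2) inv[OF V(3)] inv[OF V(4)]]
  proof (elim exE notE)
    fix n :: nat
    show "\<exists>p q x. \<forall>i<n. \<forall>j<n.
           (\<forall>i'<n. satisfies ?M ((p i')(0 := x i j)) \<phi> \<longleftrightarrow> i' = i) \<and>
           (\<forall>j'<n. satisfies ?M ((q j')(0 := x i j)) \<psi> \<longleftrightarrow> j' = j)"
      using patterns[of n] univ by simp
  qed
qed

section \<open>Back-and-forth\<close>

text \<open>
  With a common multiple \<open>D\<close> of all coefficients that the new variable can have, every sign condition on
  \<open>a\<close> becomes a comparison of \<open>D\<close> times \<open>f a\<close> with a form in the old values. Only these cuts have to
  be matched.
\<close>

lemma sim_fun_upd:
  assumes V: "finite V" "k \<in> V" and D: "0 < D" "\<And>d. 1 \<le> d \<Longrightarrow> d \<le> B \<Longrightarrow> d dvd D"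
    and vw: "sim f g V B' M' v w" and B: "0 \<le> B" "B \<le> B'" and M: "M dvd M'"
    and cut: "\<And>c c0. c \<in> coeffs V (D * B) \<Longrightarrow> \<bar>c0\<bar> \<le> D * B \<Longrightarrow>
      sgn (of_int D * f a - lin f V c c0 v) = sgn (of_int D * f b - lin f V c c0 w)"
    and res: "b mod M = a mod M" "g b mod M = g a mod M"
  shows "sim f g V B M (v(k := a)) (w(k := b))"
  unfolding sim_def
proof (intro conjI ballI)
  fix c c0 assume c: "c \<in> coeffs V B" "c0 \<in> {-B..B}"
  define d where "d = c(k := 0)"
  have d: "d \<in> coeffs V B" using c B by (simp add: d_def coeffs_fun_upd)
  have upd: "lin f V c c0 (u(k := x)) = of_int (c k) * f x + lin f V d c0 u" for u x
    unfolding d_def by (rule lin_fun_upd[OF V])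
  show "sgn (lin f V c c0 (v(k := a))) = sgn (lin f V c c0 (w(k := b)))"
  proof (cases "c k = 0")
    case True
    then show ?thesis
      using sim_sgn[OF vw coeffs_mono[OF d B(2)], of c0] c B by (simp add: upd abs_le_iff)
  next
    case False
    have "\<bar>c k\<bar> dvd D" using False c V by (intro D(2)) (auto simp: coeffs_def)
    then have "c k dvd D" by simp
    then obtain m where m: "D = c k * m" by (rule dvdE)
    then have m0: "m \<noteq> 0" using D(1) by auto
    have "\<bar>m\<bar> dvd D" using m by simp
    then have mD: "\<bar>m\<bar> \<le> D" using D(1) by (rule zdvd_imp_le)
    \<comment> \<open>scaling by \<open>m = D / c k\<close> turns the coefficient of the new variable into \<open>D\<close>\<close>
    have eq: "of_int m * lin f V c c0 (u(k := x)) = of_int D * f x - lin f V (\<lambda>i. (- m) * d i) ((- m) * c0) u"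
      for u x
      unfolding lin_scale[symmetric] upd m by (simp add: algebra_simps)
    have "(\<lambda>i. (- m) * d i) \<in> coeffs V (D * B)" using d mD by (intro coeffs_scale) auto
    moreover have "\<bar>(- m) * c0\<bar> \<le> D * B" using mD c(2) D(1) by (auto simp: abs_mult intro!: mult_mono)
    ultimately have "sgn (of_int m * lin f V c c0 (v(k := a))) = sgn (of_int m * lin f V c c0 (w(k := b)))"
      unfolding eq by (rule cut)
    then show ?thesis using m0 by (simp add: sgn_mult sgn_0_0)
  qed
next
  fix i assume "i \<in> V"
  then have "v i mod M = w i mod M" "g (v i) mod M = g (w i) mod M"
    using sim_mod[OF vw] sim_mod'[OF vw] by (blast intro: mod_eq_mono[OF M])+
  then show "(v(k := a)) i mod M = (w(k := b)) i mod M" "g ((v(k := a)) i) mod M = g ((w(k := b)) i) mod M"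
    using res by simp_all
qed

text \<open>
  If \<open>a\<close> and \<open>b\<close> are given by the same linear equation over \<open>v\<close> and \<open>w\<close>, their positions among the cuts
  agree, since differences of forms are forms.
\<close>

lemma sgn_cut_eq:
  assumes vw: "sim f g V B' M' v w" and e: "e \<in> coeffs V E" "\<bar>e0\<bar> \<le> E" and c: "c \<in> coeffs V F" "\<bar>c0\<bar> \<le> F"
    and le: "E + F \<le> B'"
  shows "sgn (lin f V e e0 v - lin f V c c0 v) = sgn (lin f V e e0 w - lin f V c c0 w)"
  unfolding lin_diff
  by (rule sim_sgn[OF vw]) (use coeffs_mono[OF coeffs_diff[OF e(1) c(1)] le] e(2) c(2) le in auto)

lemma sum_mult_mod_cong:
  fixes v w :: "nat \<Rightarrow> int"
  assumes "\<And>i. i \<in> V \<Longrightarrow> v i mod m = w i mod m"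
  shows "(\<Sum>i\<in>V. c i * v i) mod m = (\<Sum>i\<in>V. c i * w i) mod m"
proof -
  have "m dvd (\<Sum>i\<in>V. c i * (v i - w i))"
    using assms by (intro dvd_sum dvd_mult) (simp add: mod_eq_dvd_iff)
  then show ?thesis by (simp add: mod_eq_dvd_iff right_diff_distrib sum_subtractf)
qed

text \<open>
  This is why the modulus has to be multiplied by \<open>D\<close> in a back-and-forth step.
\<close>

lemma divide_residue:
  fixes D M a s t :: int
  assumes "D * a = s" "s mod (D * M) = t mod (D * M)"
  shows "\<exists>b. D * b = t \<and> b mod M = a mod M"
proof -
  obtain k where "t - s = D * M * k" using assms(2) by (metis mod_eq_dvd_iff dvdE)
  then have "D * (a + M * k) = t" using assms(1) by (simp add: algebra_simps)
  then show ?thesis by (intro exI[of _ "a + M * k"]) simp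
qed

lemma common_multiple: "\<exists>D>0. \<forall>d. 1 \<le> d \<longrightarrow> d \<le> B \<longrightarrow> d dvd (D :: int)"
proof (intro exI conjI allI impI)
  show "0 < \<Prod>{1..B}" by (rule prod_pos) auto
  show "d dvd \<Prod>{1..B}" if "1 \<le> d" "d \<le> B" for d
    using dvd_prodI[of "{1..B}" d "\<lambda>x. x"] that by simp
qed

text \<open>
  Fixes bounds that serve both instances: coefficients up to \<open>2DB\<close> compare two cuts, and the summand
  \<open>DM\<close> makes it possible to say that a gap in the discrete case has room for a full period of residues.
\<close>

lemma back_and_forthI:
  assumes "\<And>V D B M v w a. finite V \<Longrightarrow> 0 < D \<Longrightarrow> 1 \<le> B \<Longrightarrow> 1 \<le> M \<Longrightarrow>
    sim f g V (2 * D * B + D * M) (D * M) v w \<Longrightarrow>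
    \<exists>b. b mod M = a mod M \<and> g b mod M = g a mod M \<and>
      (\<forall>c\<in>coeffs V (D * B). \<forall>c0. \<bar>c0\<bar> \<le> D * B \<longrightarrow>
        sgn (of_int D * f a - lin f V c c0 v) = sgn (of_int D * f b - lin f V c c0 w))"
  shows "back_and_forth f g"
  unfolding back_and_forth_def
proof (intro allI impI)
  fix V :: "nat set" and k and B M :: int
  assume V: "finite V" "k \<in> V" and B: "1 \<le> B" and M: "1 \<le> M"
  obtain D :: int where D: "0 < D" "\<And>d. 1 \<le> d \<Longrightarrow> d \<le> B \<Longrightarrow> d dvd D" using common_multiple by blast
  have DM: "1 \<le> D * M" using mult_mono[of 1 D 1 M] D(1) M by simp
  have DB: "B \<le> D * B" using mult_right_mono[of 1 D B] D(1) B by simp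
  show "\<exists>B'\<ge>1. \<exists>M'\<ge>1. \<forall>v w a. sim f g V B' M' v w \<longrightarrow> (\<exists>b. sim f g V B M (v(k := a)) (w(k := b)))"
  proof (rule exI[of _ "2 * D * B + D * M"], rule conjI[OF _ exI[of _ "D * M"]], goal_cases)
    case 1
    then show ?case using DM DB B by linarith
  next
    case 2
    show ?case
    proof (intro conjI allI impI DM)
      fix v w a assume vw: "sim f g V (2 * D * B + D * M) (D * M) v w"
      obtain b where b: "b mod M = a mod M" "g b mod M = g a mod M"
        "\<And>c c0. c \<in> coeffs V (D * B) \<Longrightarrow> \<bar>c0\<bar> \<le> D * B \<Longrightarrow>
          sgn (of_int D * f a - lin f V c c0 v) = sgn (of_int D * f b - lin f V c c0 w)"
        using assms[OF V(1) D(1) B M vw, of a] by blast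
      have "sim f g V B M (v(k := a)) (w(k := b))"
      proof (rule sim_fun_upd[OF V D vw _ _ _ b(3,1,2)])
        show "B \<le> 2 * D * B + D * M" using B DM DB by linarith
      qed (use B in auto)
      then show "\<exists>b. sim f g V B M (v(k := a)) (w(k := b))" by blast
    qed
  qed
qed

lemma lin_of_int: "lin of_int V c c0 v = of_int ((\<Sum>i\<in>V. c i * v i) + c0)"
  by (simp add: lin_def)

lemma pos_if_sgn_eq: "sgn (real_of_int m) = sgn (of_int n) \<Longrightarrow> 0 < m \<Longrightarrow> 0 < n"
  by (simp add: sgn_if split: if_splits)

lemma sgn_of_int_cong: "sgn m = sgn n \<Longrightarrow> sgn (real_of_int m) = sgn (real_of_int n)"
  by (simp add: sgn_if split: if_splits)

lemma residue_between:
  fixes a D M p :: int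
  assumes "0 < D" "1 \<le> M"
  shows "\<exists>b. b mod M = a mod M \<and> p < D * b \<and> D * b \<le> p + D * M"
proof -
  define t where "t = (p - D * a) div (D * M) + 1"
  have DM: "0 < D * M" using assms by simp
  have "(p - D * a) mod (D * M) = (p - D * a) - (t - 1) * (D * M)"
    by (simp add: t_def minus_div_mult_eq_mod)
  then have "0 \<le> (p - D * a) - (t - 1) * (D * M)" "(p - D * a) - (t - 1) * (D * M) < D * M"
    using DM by (metis pos_mod_sign, metis pos_mod_bound)
  then show ?thesis by (intro exI[of _ "a + M * t"]) (auto simp: algebra_simps)
qed

text \<open>
  Cuts may lie close together here, so equations are tried with constants up to \<open>DB + DM\<close>. If none of
  them holds, then \<open>D a\<close> is more than \<open>DM\<close> above every lower cut, and this lower bound for the gap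
  carries over to \<open>w\<close>, where it leaves room for a multiple of \<open>D\<close> with the correct residue.
\<close>

lemma back_and_forth_discrete: "back_and_forth of_int (\<lambda>_. 0)"
proof (rule back_and_forthI)
  fix V and D B M :: int and v w :: "nat \<Rightarrow> int" and a
  assume V: "finite V" and D: "0 < D" and B: "1 \<le> B" and M: "1 \<le> M"
    and vw: "sim of_int (\<lambda>_. 0) V (2 * D * B + D * M) (D * M) v w"
  let ?L = "\<lambda>x u. (\<Sum>i\<in>V. fst x i * u i) + snd x"
  have L: "lin of_int V c c0 u = of_int (?L (c, c0) u)" for c c0 u by (simp add: lin_of_int)
  have DM: "0 < D * M" using D M by simp
  have "\<exists>b. b mod M = a mod M \<and> (\<forall>c\<in>coeffs V (D * B). \<forall>c0. \<bar>c0\<bar> \<le> D * B \<longrightarrow>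
        sgn (of_int D * of_int a - lin of_int V c c0 v) = sgn (of_int D * of_int b - lin of_int V c c0 w))"
  proof (cases "\<exists>e\<in>coeffs V (D * B). \<exists>e0. \<bar>e0\<bar> \<le> D * B + D * M \<and> D * a = ?L (e, e0) v")
    case True
    then obtain e e0 where e: "e \<in> coeffs V (D * B)" "\<bar>e0\<bar> \<le> D * B + D * M" "D * a = ?L (e, e0) v" by blast
    have "(\<Sum>i\<in>V. e i * v i) mod (D * M) = (\<Sum>i\<in>V. e i * w i) mod (D * M)"
      using sim_mod[OF vw] by (rule sum_mult_mod_cong)
    then have "?L (e, e0) v mod (D * M) = ?L (e, e0) w mod (D * M)"
      by (simp add: mod_eq_dvd_iff)
    then obtain b where b: "D * b = ?L (e, e0) w" "b mod M = a mod M"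
      using divide_residue e(3) by blast
    have "of_int D * of_int a = lin of_int V e e0 v" "of_int D * of_int b = lin of_int V e e0 w"
      unfolding L of_int_mult[symmetric] e(3) b(1) by simp_all
    then show ?thesis
      using sgn_cut_eq[OF vw coeffs_mono[OF e(1)] e(2)] b(2) DM by (intro exI[of _ b]) simp
  next
    case False
    let ?E = "coeffs V (D * B) \<times> {-(D * B)..D * B}"
    define X where "X = {x \<in> ?E. ?L x v < D * a}"
    define Y where "Y = {x \<in> ?E. D * a < ?L x v}"
    have fin: "finite X" "finite Y" using V by (auto simp: X_def Y_def finite_coeffs)
    have XY: "x \<in> X \<or> x \<in> Y" if "x \<in> ?E" for x
    proof -
      have "fst x \<in> coeffs V (D * B)" "\<bar>snd x\<bar> \<le> D * B + D * M" using that DM by (auto simp: abs_le_iff)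
      then have "D * a \<noteq> ?L x v" using False by auto
      then show ?thesis using that by (auto simp: X_def Y_def)
    qed
    have gap_v: "?L x v + D * M < ?L y v" if x: "x \<in> X" and y: "y \<in> Y" for x y
    proof (rule ccontr)
      assume neg: "\<not> ?thesis"
      define t where "t = D * a - ?L x v"
      have t: "0 < t" "t < D * M" using x y neg by (auto simp: t_def X_def Y_def)
      have x': "fst x \<in> coeffs V (D * B)" "\<bar>snd x\<bar> \<le> D * B" using x by (auto simp: X_def abs_le_iff)
      have "\<bar>snd x + t\<bar> \<le> D * B + D * M" using t x'(2) by linarith
      then have "D * a \<noteq> ?L (fst x, snd x + t) v" using False x'(1) by blast
      then show False by (simp add: t_def)
    qed
    have gap_w: "?L x w + D * M < ?L y w" if x: "x \<in> X" and y: "y \<in> Y" for x y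
    proof -
      have "(\<lambda>i. fst y i - fst x i) \<in> coeffs V (D * B + D * B)"
        using x y by (intro coeffs_diff) (auto simp: X_def Y_def)
      then have 1: "(\<lambda>i. fst y i - fst x i) \<in> coeffs V (2 * D * B + D * M)"
        by (rule coeffs_mono) (use DM in auto)
      have 2: "\<bar>snd y - snd x - D * M\<bar> \<le> 2 * D * B + D * M" using x y DM by (auto simp: X_def Y_def)
      have lin: "lin of_int V (\<lambda>i. fst y i - fst x i) (snd y - snd x - D * M) u
          = of_int (?L y u - (?L x u + D * M))" for u
        by (simp add: lin_of_int left_diff_distrib sum_subtractf)
      have "0 < ?L y v - (?L x v + D * M)" using gap_v[OF x y] by simp
      then have "0 < ?L y w - (?L x w + D * M)"
        by (rule pos_if_sgn_eq[OF sim_sgn[OF vw 1 2, unfolded lin]])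
      then show ?thesis by simp
    qed
    have "\<exists>b. b mod M = a mod M \<and> (\<forall>x\<in>X. ?L x w < D * b) \<and> (\<forall>y\<in>Y. D * b < ?L y w)"
    proof (cases "X = {}")
      case False
      define p where "p = Max ((\<lambda>x. ?L x w) ` X)"
      have p: "\<And>x. x \<in> X \<Longrightarrow> ?L x w \<le> p" "p \<in> (\<lambda>x. ?L x w) ` X"
        unfolding p_def using fin False by (auto intro!: Max_ge Max_in)
      obtain b where "b mod M = a mod M" "p < D * b" "D * b \<le> p + D * M"
        using residue_between[OF D M] by blast
      then show ?thesis using p gap_w by (intro exI[of _ b]) (auto intro: order.strict_trans1)
    next
      case True
      \<comment> \<open>there may be no upper cut at all, and \<open>0\<close> makes the minimum well defined\<close>
      define q where "q = Min (insert 0 ((\<lambda>x. ?L x w) ` Y))"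
      have q: "\<And>y. y \<in> Y \<Longrightarrow> q \<le> ?L y w" unfolding q_def using fin by auto
      obtain b where "b mod M = a mod M" "D * b \<le> (q - D * M - 1) + D * M"
        using residue_between[OF D M] by blast
      then show ?thesis using True q by (intro exI[of _ b]) force
    qed
    then obtain b where b: "b mod M = a mod M" "\<And>x. x \<in> X \<Longrightarrow> ?L x w < D * b"
      "\<And>y. y \<in> Y \<Longrightarrow> D * b < ?L y w" by blast
    have sgn_eq: "sgn (D * a - ?L (c, c0) v) = sgn (D * b - ?L (c, c0) w)"
      if "c \<in> coeffs V (D * B)" "\<bar>c0\<bar> \<le> D * B" for c c0
      using XY[of "(c, c0)"]
    proof
      show "(c, c0) \<in> ?E" using that by (simp add: abs_le_iff)
    next
      assume "(c, c0) \<in> X"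
      then show ?thesis using b(2)[of "(c, c0)"] by (simp add: X_def)
    next
      assume "(c, c0) \<in> Y"
      then show ?thesis using b(3)[of "(c, c0)"] by (simp add: Y_def)
    qed
    have "sgn (of_int D * of_int a - lin of_int V c c0 v) = sgn (of_int D * of_int b - lin of_int V c c0 w)"
      if "c \<in> coeffs V (D * B)" "\<bar>c0\<bar> \<le> D * B" for c c0
      unfolding L of_int_mult[symmetric] of_int_diff[symmetric] by (rule sgn_of_int_cong) (rule sgn_eq[OF that])
    with b(1) show ?thesis by blast
  qed
  then show "\<exists>b. b mod M = a mod M \<and> 0 mod M = 0 mod M \<and> (\<forall>c\<in>coeffs V (D * B). \<forall>c0. \<bar>c0\<bar> \<le> D * B \<longrightarrow>
        sgn (of_int D * of_int a - lin of_int V c c0 v) = sgn (of_int D * of_int b - lin of_int V c c0 w))"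
    by simp
qed

text \<open>
  The elements \<open>1\<close> and \<open>\<alpha>\<close> are independent over \<open>\<int>\<close>, so an equation in \<open>\<int> + \<int>\<alpha>\<close> can be read off coordinatewise.
\<close>

lemma irrational_combination:
  fixes \<alpha> :: real and x y :: int
  assumes "\<alpha> \<notin> \<rat>" "of_int x * \<alpha> = of_int y"
  shows "x = 0" "y = 0"
proof -
  show "x = 0"
  proof (rule ccontr)
    assume "x \<noteq> 0"
    then have "\<alpha> = of_int y / of_int x" using assms(2) by (simp add: field_simps)
    then show False using assms(1) by simp
  qed
  then show "y = 0" using assms(2) by simp
qed

text \<open>
  Kronecker's theorem for \<open>\<alpha>\<close>, applied after the affine change of variables \<open>b = r + M k\<close>, \<open>l = s + M h\<close>.
\<close>

lemma residues_dense:
  fixes \<alpha> p q :: real and M r s :: int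
  assumes "\<alpha> \<notin> \<rat>" "p < q" "1 \<le> M"
  shows "\<exists>b l. b mod M = r mod M \<and> l mod M = s mod M \<and> p < of_int b * \<alpha> - of_int l \<and> of_int b * \<alpha> - of_int l < q"
proof -
  let ?t = "((p + q) / 2 - (of_int r * \<alpha> - of_int s)) / of_int M"
  have M: "0 < real_of_int M" using assms(3) by simp
  have "0 < (q - p) / 2 / of_int M" using assms(2) M by simp
  then obtain h k where hk: "\<bar>of_int k * \<alpha> - of_int h - ?t\<bar> < (q - p) / 2 / of_int M"
    using sequence_of_fractional_parts_is_dense[OF assms(1), where \<alpha> = ?t] by metis
  let ?z = "of_int k * \<alpha> - of_int h"
  have "of_int M * \<bar>?z - ?t\<bar> < (q - p) / 2" using hk M by (simp add: field_simps)
  then have "\<bar>of_int M * (?z - ?t)\<bar> < (q - p) / 2" using M by (simp add: abs_mult)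
  moreover have "of_int M * (?z - ?t) = of_int (r + M * k) * \<alpha> - of_int (s + M * h) - (p + q) / 2"
    using M by (simp add: field_simps)
  ultimately have "\<bar>of_int (r + M * k) * \<alpha> - of_int (s + M * h) - (p + q) / 2\<bar> < (q - p) / 2" by simp
  then have "p < of_int (r + M * k) * \<alpha> - of_int (s + M * h)" "of_int (r + M * k) * \<alpha> - of_int (s + M * h) < q"
    unfolding abs_less_iff by argo+
  then show ?thesis by (intro exI[of _ "r + M * k"] exI[of _ "s + M * h"]) simp
qed

text \<open>
  Everything takes place in \<open>\<int> + \<int>\<alpha>\<close>, with \<open>f\<close> enumerating its elements in the unit interval. The
  constant forms \<open>0\<close> and \<open>D\<close> belong to the cuts, so that the element found for \<open>b\<close> is in that interval
  and hence is a value of \<open>f\<close>.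
\<close>

lemma back_and_forth_dense:
  fixes \<alpha> :: real
  assumes irr: "\<alpha> \<notin> \<rat>"
  shows "back_and_forth (\<lambda>n. frac (of_int n * \<alpha>)) (\<lambda>n. \<lfloor>of_int n * \<alpha>\<rfloor>)"
proof (rule back_and_forthI)
  fix V and D B M :: int and v w :: "nat \<Rightarrow> int" and a
  define f where "f n = frac (of_int n * \<alpha>)" for n :: int
  define g where "g n = \<lfloor>of_int n * \<alpha>\<rfloor>" for n :: int
  assume V: "finite V" and D: "0 < D" and B: "1 \<le> B" and M: "1 \<le> M"
    and "sim (\<lambda>n. frac (of_int n * \<alpha>)) (\<lambda>n. \<lfloor>of_int n * \<alpha>\<rfloor>) V (2 * D * B + D * M) (D * M) v w"
  then have vw: "sim f g V (2 * D * B + D * M) (D * M) v w" by (simp add: f_def[abs_def] g_def[abs_def])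
  have DM: "0 < D * M" using D M by simp
  have DB: "D \<le> D * B" using mult_left_mono[of 1 B D] D B by simp
  have f_eq: "f n = of_int n * \<alpha> - of_int (g n)" for n by (simp add: f_def g_def frac_def)
  have f: "0 \<le> f n" "f n < 1" for n by (simp_all add: f_def frac_lt_1)
  have g_eq: "g n = l" if "0 \<le> of_int n * \<alpha> - of_int l" "of_int n * \<alpha> - of_int l < 1" for n l
    unfolding g_def using that by (intro floor_unique) auto
  have lin_eq: "lin f V e e0 u = of_int (\<Sum>i\<in>V. e i * u i) * \<alpha> - of_int ((\<Sum>i\<in>V. e i * g (u i)) - e0)" for e e0 u
    by (simp add: lin_def f_eq right_diff_distrib sum_subtractf sum_distrib_right mult.assoc)
  have "\<exists>b. b mod M = a mod M \<and> g b mod M = g a mod M \<and>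
      (\<forall>c\<in>coeffs V (D * B). \<forall>c0. \<bar>c0\<bar> \<le> D * B \<longrightarrow>
        sgn (of_int D * f a - lin f V c c0 v) = sgn (of_int D * f b - lin f V c c0 w))"
  proof (cases "\<exists>e\<in>coeffs V (D * B). \<exists>e0. \<bar>e0\<bar> \<le> D * B \<and> of_int D * f a = lin f V e e0 v")
    case True
    then obtain e e0 where e: "e \<in> coeffs V (D * B)" "\<bar>e0\<bar> \<le> D * B" "of_int D * f a = lin f V e e0 v" by blast
    let ?s = "\<lambda>u. \<Sum>i\<in>V. e i * u i"
    \<comment> \<open>separate the equation into its \<open>\<alpha>\<close>-part and its integer part\<close>
    have "of_int (D * a - ?s v) * \<alpha> = of_int (D * g a - (?s (\<lambda>i. g (v i)) - e0))"
      using e(3) unfolding lin_eq f_eq by (simp add: algebra_simps)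
    then have da: "D * a = ?s v" "D * g a = ?s (\<lambda>i. g (v i)) - e0"
      using irrational_combination[OF irr] by fastforce+
    have "?s v mod (D * M) = ?s w mod (D * M)"
      using sim_mod[OF vw] by (rule sum_mult_mod_cong)
    then obtain b where b: "D * b = ?s w" "b mod M = a mod M" using divide_residue da(1) by blast
    have "?s (\<lambda>i. g (v i)) mod (D * M) = ?s (\<lambda>i. g (w i)) mod (D * M)"
      using sim_mod'[OF vw] by (rule sum_mult_mod_cong)
    then have "(?s (\<lambda>i. g (v i)) - e0) mod (D * M) = (?s (\<lambda>i. g (w i)) - e0) mod (D * M)"
      by (simp add: mod_eq_dvd_iff)
    then obtain l where l: "D * l = ?s (\<lambda>i. g (w i)) - e0" "l mod M = g a mod M"
      using divide_residue da(2) by blast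
    have lin_w: "of_int D * (of_int b * \<alpha> - of_int l) = lin f V e e0 w"
      unfolding lin_eq b(1)[symmetric] l(1)[symmetric] by (simp add: algebra_simps)
    have "sgn (lin f V e e0 v) = sgn (lin f V e e0 w)"
      using coeffs_mono[OF e(1)] e(2) DM DB D by (intro sim_sgn[OF vw]) auto
    moreover have "0 \<le> lin f V e e0 v" using e(3)[symmetric] f D by simp
    ultimately have "0 \<le> lin f V e e0 w" by (auto simp: sgn_if split: if_splits)
    \<comment> \<open>\<open>0 \<le> lin f V e e0 w < D\<close> makes \<open>l\<close> the integer part of \<open>b\<alpha>\<close>\<close>
    moreover have "lin f V e e0 w < of_int D"
    proof -
      have "\<bar>e0 - D\<bar> \<le> 2 * D * B + D * M" using e(2) DM DB D by linarith
      moreover have "e \<in> coeffs V (2 * D * B + D * M)" using DM DB D by (intro coeffs_mono[OF e(1)]) linarith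
      ultimately have "sgn (lin f V e (e0 - D) v) = sgn (lin f V e (e0 - D) w)"
        using sim_sgn[OF vw] by blast
      moreover have "lin f V e (e0 - D) u = lin f V e e0 u - of_int D" for u by (simp add: lin_def)
      moreover have "lin f V e e0 v < of_int D" using e(3)[symmetric] f(2)[of a] D by simp
      ultimately show ?thesis by (auto simp: sgn_if split: if_splits)
    qed
    ultimately have "g b = l"
      using D unfolding lin_w[symmetric] by (intro g_eq) (auto simp: zero_le_mult_iff)
    then have "of_int D * f b = lin f V e e0 w" using lin_w by (simp add: f_eq)
    then show ?thesis
      using sgn_cut_eq[OF vw e(1,2)] e(3) b(2) l(2) DM \<open>g b = l\<close> by (intro exI[of _ b]) simp
  next
    case False
    let ?L = "\<lambda>x. lin f V (fst x) (snd x)"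
    let ?E = "coeffs V (D * B) \<times> {-(D * B)..D * B}"
    define X where "X = {x \<in> ?E. ?L x v < of_int D * f a}"
    define Y where "Y = {x \<in> ?E. of_int D * f a < ?L x v}"
    have fin: "finite X" "finite Y" using V by (auto simp: X_def Y_def finite_coeffs)
    have XY: "x \<in> X \<or> x \<in> Y" if "x \<in> ?E" for x
    proof -
      have "of_int D * f a \<noteq> ?L x v" using False that by (cases x) (auto simp: abs_le_iff)
      then show ?thesis using that by (auto simp: X_def Y_def)
    qed
    have const: "lin f V (\<lambda>_. 0) m u = of_int m" for m u by (simp add: lin_def)
    have zero: "(\<lambda>_. 0, m) \<in> ?E" if "m = 0 \<or> m = D" for m
    proof -
      have "\<bar>m\<bar> \<le> D * B" using that DB D by linarith
      then show ?thesis by (simp add: abs_le_iff zero_in_coeffs)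
    qed
    have X0: "(\<lambda>_. 0, 0) \<in> X"
    proof -
      have "(\<lambda>_. 0, 0) \<notin> Y" using f(1)[of a] D by (auto simp: Y_def const not_less)
      then show ?thesis using XY zero by blast
    qed
    have YD: "(\<lambda>_. 0, D) \<in> Y"
    proof -
      have "(\<lambda>_. 0, D) \<in> ?E" using zero by blast
      then show ?thesis using f(2)[of a] D by (simp add: Y_def const)
    qed
    have less_w: "?L x w < ?L y w" if x: "x \<in> X" and y: "y \<in> Y" for x y
    proof -
      have "sgn (?L y v - ?L x v) = sgn (?L y w - ?L x w)"
        using x y DM by (intro sgn_cut_eq[OF vw]) (auto simp: X_def Y_def)
      moreover have "?L x v < ?L y v" using x y by (auto simp: X_def Y_def)
      ultimately show ?thesis by (simp add: sgn_if split: if_splits)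
    qed
    define p where "p = Max ((\<lambda>x. ?L x w) ` X)"
    define q where "q = Min ((\<lambda>x. ?L x w) ` Y)"
    have p: "\<And>x. x \<in> X \<Longrightarrow> ?L x w \<le> p" "p \<in> (\<lambda>x. ?L x w) ` X"
      unfolding p_def using fin X0 by (auto intro!: Max_ge Max_in)
    have q: "\<And>y. y \<in> Y \<Longrightarrow> q \<le> ?L y w" "q \<in> (\<lambda>x. ?L x w) ` Y"
      unfolding q_def using fin YD by (auto intro!: Min_le Min_in)
    have "p < q" using p(2) q(2) less_w by auto
    have pq: "0 \<le> p" "q \<le> of_int D" using p(1)[OF X0] q(1)[OF YD] by (simp_all add: const)
    obtain b l where b: "b mod M = a mod M" "l mod M = g a mod M"
      and pb: "p / of_int D < of_int b * \<alpha> - of_int l" and bq: "of_int b * \<alpha> - of_int l < q / of_int D"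
      using residues_dense[OF irr, of "p / of_int D" "q / of_int D" M a "g a"] \<open>p < q\<close> D M
      by (auto simp: divide_strict_right_mono)
    have "0 \<le> p / of_int D" "q / of_int D \<le> 1" using pq D by simp_all
    then have "g b = l" using pb bq by (intro g_eq) linarith+
    then have fb: "p < of_int D * f b" "of_int D * f b < q"
      using pb bq D by (simp_all add: f_eq field_simps)
    have "sgn (of_int D * f a - lin f V c c0 v) = sgn (of_int D * f b - lin f V c c0 w)"
      if "c \<in> coeffs V (D * B)" "\<bar>c0\<bar> \<le> D * B" for c c0
      using XY[of "(c, c0)"]
    proof
      show "(c, c0) \<in> ?E" using that by (simp add: abs_le_iff)
    next
      assume "(c, c0) \<in> X"
      then show ?thesis using p(1)[of "(c, c0)"] fb by (simp add: X_def)
    next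
      assume "(c, c0) \<in> Y"
      then show ?thesis using q(1)[of "(c, c0)"] fb by (simp add: Y_def)
    qed
    then show ?thesis using b \<open>g b = l\<close> by blast
  qed
  then show "\<exists>b. b mod M = a mod M \<and> \<lfloor>of_int b * \<alpha>\<rfloor> mod M = \<lfloor>of_int a * \<alpha>\<rfloor> mod M \<and>
      (\<forall>c\<in>coeffs V (D * B). \<forall>c0. \<bar>c0\<bar> \<le> D * B \<longrightarrow>
        sgn (of_int D * frac (of_int a * \<alpha>) - lin (\<lambda>n. frac (of_int n * \<alpha>)) V c c0 v)
        = sgn (of_int D * frac (of_int b * \<alpha>) - lin (\<lambda>n. frac (of_int n * \<alpha>)) V c c0 w))"
    by (simp add: f_def[abs_def] g_def[abs_def])
qed

section \<open>Values of terms\<close>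

primrec term_coeff :: "cyc_term \<Rightarrow> nat \<Rightarrow> int" where
  "term_coeff (Var n) = (\<lambda>i. if i = n then 1 else 0)"
| "term_coeff (Plus s t) = (\<lambda>i. term_coeff s i + term_coeff t i)"

primrec term_length :: "cyc_term \<Rightarrow> int" where
  "term_length (Var n) = 1"
| "term_length (Plus s t) = term_length s + term_length t"

lemma term_length_pos: "0 < term_length t"
  by (induction t) auto

lemma term_coeff_nonneg: "0 \<le> term_coeff t i"
  by (induction t) auto

lemma term_coeff_in_coeffs:
  assumes "term_vars t \<subseteq> V"
  shows "term_coeff t \<in> coeffs V (term_length t)"
proof -
  have "term_coeff t i \<le> term_length t" for i
    using term_length_pos by (induction t) (auto intro: add_mono)
  moreover have "i \<notin> term_vars t \<Longrightarrow> term_coeff t i = 0" for i by (induction t) auto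
  ultimately show ?thesis using assms term_coeff_nonneg by (auto simp: coeffs_def)
qed

lemma sum_term_coeff: "finite V \<Longrightarrow> term_vars t \<subseteq> V \<Longrightarrow> (\<Sum>i\<in>V. term_coeff t i) = term_length t"
  by (induction t) (auto simp: sum.distrib)

lemma term_value_eq_sum:
  assumes "finite V"
  shows "term_vars t \<subseteq> V \<Longrightarrow> term_value (group_structure C) v t = (\<Sum>i\<in>V. term_coeff t i * v i)"
proof (induction t)
  case (Var n)
  have "(\<Sum>i\<in>V. (if i = n then 1 else 0) * v i) = (\<Sum>i\<in>V. if i = n then v i else 0)"
    by (rule sum.cong) auto
  then show ?case using Var assms by simp
qed (auto simp: group_structure_def sum.distrib distrib_right)

lemma sgn_term_diff_discrete:
  fixes C :: "(int \<times> int \<times> int) set"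
  assumes V: "finite V" "term_vars s \<union> term_vars t \<subseteq> V"
    and vw: "sim of_int g V (term_length s + term_length t) M v w"
  shows "sgn (real_of_int (term_value (group_structure C) v s) - of_int (term_value (group_structure C) v t))
    = sgn (real_of_int (term_value (group_structure C) w s) - of_int (term_value (group_structure C) w t))"
proof -
  have "(\<lambda>i. term_coeff s i - term_coeff t i) \<in> coeffs V (term_length s + term_length t)"
    using V by (intro coeffs_diff term_coeff_in_coeffs) auto
  moreover have "real_of_int (term_value (group_structure C) u s) - of_int (term_value (group_structure C) u t)
      = lin of_int V (\<lambda>i. term_coeff s i - term_coeff t i) 0 u" for u
    using V by (simp add: term_value_eq_sum[OF V(1)] lin_def left_diff_distrib sum_subtractf)
  moreover have "\<bar>0\<bar> \<le> term_length s + term_length t"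
    using term_length_pos[of s] term_length_pos[of t] by simp
  ultimately show ?thesis using sim_sgn[OF vw] by metis
qed

lemma nonneg_if_sgn_eq: "sgn x = sgn y \<Longrightarrow> 0 \<le> x \<Longrightarrow> 0 \<le> y" for x y :: real
  by (metis zero_le_sgn_iff)

lemma neg_if_sgn_eq: "sgn x = sgn y \<Longrightarrow> x < 0 \<Longrightarrow> y < 0" for x y :: real
  by (metis sgn_less)

lemma frac_diff_of_int: "frac (x - of_int n) = frac (x :: real)"
  by (simp add: frac_def)

text \<open>
  The value of a term under \<open>f\<close> is the fractional part of a form \<open>L\<close> with nonnegative coefficients. The
  integer part of \<open>L\<close> is between \<open>0\<close> and the length of the term, hence is determined by boundedly many
  signs; once it is known, fractional parts are compared by the sign of a form.
\<close>

lemma sgn_term_diff_dense: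
  fixes C :: "(int \<times> int \<times> int) set" and \<alpha> :: real
  defines "f \<equiv> \<lambda>n :: int. frac (of_int n * \<alpha>)"
  assumes V: "finite V" "term_vars s \<union> term_vars t \<subseteq> V"
    and vw: "sim f g V (term_length s + term_length t) M v w"
  shows "sgn (f (term_value (group_structure C) v s) - f (term_value (group_structure C) v t))
    = sgn (f (term_value (group_structure C) w s) - f (term_value (group_structure C) w t))"
proof -
  let ?B = "term_length s + term_length t"
  let ?L = "\<lambda>r u. lin f V (term_coeff r) 0 u"
  have f: "f n = of_int n * \<alpha> - of_int \<lfloor>of_int n * \<alpha>\<rfloor>" "0 \<le> f n" "f n \<le> 1" for n
    unfolding f_def using frac_lt_1[of "of_int n * \<alpha>"] by (simp_all add: frac_def)
  have f_value: "f (term_value (group_structure C) u r) = frac (?L r u)" if "term_vars r \<subseteq> V" for r u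
  proof -
    have "?L r u = of_int (term_value (group_structure C) u r) * \<alpha>
        - of_int (\<Sum>i\<in>V. term_coeff r i * \<lfloor>of_int (u i) * \<alpha>\<rfloor>)"
      by (simp add: lin_def f(1) term_value_eq_sum[OF V(1) that] right_diff_distrib sum_subtractf
          sum_distrib_right mult.assoc)
    then show ?thesis unfolding f_def by (simp only: frac_diff_of_int)
  qed
  have floor_range: "0 \<le> \<lfloor>?L r u\<rfloor>" "\<lfloor>?L r u\<rfloor> \<le> term_length r" if "term_vars r \<subseteq> V" for r u
  proof -
    have "0 \<le> ?L r u"
      unfolding lin_def using f(2) term_coeff_nonneg by (simp add: sum_nonneg)
    then show "0 \<le> \<lfloor>?L r u\<rfloor>" by simp
    have "?L r u \<le> (\<Sum>i\<in>V. of_int (term_coeff r i))"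
      unfolding lin_def using f(3) term_coeff_nonneg by (auto intro!: sum_mono mult_right_le_one_le f(2))
    then have "?L r u \<le> of_int (term_length r)"
      using sum_term_coeff[OF V(1) that] by (simp flip: of_int_sum)
    then show "\<lfloor>?L r u\<rfloor> \<le> term_length r" by (simp add: floor_le_iff)
  qed
  have floor_eq: "\<lfloor>?L r v\<rfloor> = \<lfloor>?L r w\<rfloor>" if r: "term_vars r \<subseteq> V" "term_length r < ?B" for r
  proof -
    note k = floor_range[OF r(1), of v]
    have "term_coeff r \<in> coeffs V ?B"
      using term_coeff_in_coeffs[OF r(1)] by (rule coeffs_mono) (use r(2) in simp)
    then have sgn: "sgn (?L r v - of_int m) = sgn (?L r w - of_int m)" if "\<bar>m\<bar> \<le> ?B" for m
    proof -
      have "lin f V (term_coeff r) (- m) u = ?L r u - of_int m" for u by (simp add: lin_def)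
      then show ?thesis using sim_sgn[OF vw \<open>term_coeff r \<in> coeffs V ?B\<close>, of "- m"] that by simp
    qed
    have "0 \<le> ?L r v - of_int \<lfloor>?L r v\<rfloor>" by simp
    moreover have "\<bar>\<lfloor>?L r v\<rfloor>\<bar> \<le> ?B" using k r(2) by linarith
    ultimately have lower: "of_int \<lfloor>?L r v\<rfloor> \<le> ?L r w"
      using nonneg_if_sgn_eq[OF sgn, of "\<lfloor>?L r v\<rfloor>"] by simp
    have "?L r v - of_int (\<lfloor>?L r v\<rfloor> + 1) < 0" using floor_correct[of "?L r v"] by simp
    moreover have "\<bar>\<lfloor>?L r v\<rfloor> + 1\<bar> \<le> ?B" using k r(2) by linarith
    ultimately have "?L r w < of_int (\<lfloor>?L r v\<rfloor> + 1)"
      using neg_if_sgn_eq[OF sgn, of "\<lfloor>?L r v\<rfloor> + 1"] by simp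
    with lower show ?thesis by (intro floor_unique[symmetric]) auto
  qed
  have vars: "term_vars s \<subseteq> V" "term_vars t \<subseteq> V" using V(2) by auto
  let ?c = "\<lambda>i. term_coeff s i - term_coeff t i" and ?k = "\<lfloor>?L t v\<rfloor> - \<lfloor>?L s v\<rfloor>"
  have floors: "\<lfloor>?L s v\<rfloor> = \<lfloor>?L s w\<rfloor>" "\<lfloor>?L t v\<rfloor> = \<lfloor>?L t w\<rfloor>"
    using floor_eq vars term_length_pos[of s] term_length_pos[of t] by simp_all
  have diff: "frac (?L s u) - frac (?L t u) = lin f V ?c (\<lfloor>?L t u\<rfloor> - \<lfloor>?L s u\<rfloor>) u" for u
    by (simp add: frac_def lin_def left_diff_distrib sum_subtractf)
  have "?c \<in> coeffs V ?B" using vars by (intro coeffs_diff term_coeff_in_coeffs)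
  moreover have "\<bar>?k\<bar> \<le> ?B"
  proof -
    show ?thesis
      using floor_range[OF vars(1), of v] floor_range[OF vars(2), of v] by linarith
  qed
  ultimately have "sgn (lin f V ?c ?k v) = sgn (lin f V ?c ?k w)" by (rule sim_sgn[OF vw])
  then show ?thesis unfolding f_value[OF vars(1)] f_value[OF vars(2)] diff floors by simp
qed

text \<open>
  The interface to the classification: it is enough that \<open>C\<close> is determined by the order that \<open>f\<close>
  induces and by residues.
\<close>

lemma dp_minimal_if_order_and_residues:
  fixes C :: "(int \<times> int \<times> int) set"
  assumes bf: "back_and_forth f g" and inj: "inj f" and q: "1 \<le> q"
    and terms: "\<And>V s t M v w. finite V \<Longrightarrow> term_vars s \<union> term_vars t \<subseteq> V \<Longrightarrow>
      sim f g V (term_length s + term_length t) M v w \<Longrightarrow>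
      sgn (f (term_value (group_structure C) v s) - f (term_value (group_structure C) v t))
      = sgn (f (term_value (group_structure C) w s) - f (term_value (group_structure C) w t))"
    and C: "\<And>a b c a' b' c'. (a, b, c) \<in> C \<Longrightarrow> a mod q = a' mod q \<Longrightarrow> b mod q = b' mod q \<Longrightarrow> c mod q = c' mod q
      \<Longrightarrow> sgn (f a - f b) = sgn (f a' - f b') \<Longrightarrow> sgn (f b - f c) = sgn (f b' - f c')
      \<Longrightarrow> sgn (f a - f c) = sgn (f a' - f c') \<Longrightarrow> (a', b', c') \<in> C"
  shows "dp_minimal TYPE('u) (group_structure C)"
proof (rule dp_minimal_if_back_and_forth[OF bf])
  fix V :: "nat set" and s t
  assume V: "finite V" "term_vars s \<union> term_vars t \<subseteq> V"
  show "sim_invariant f g V (\<lambda>v. satisfies (group_structure C) v (Equal s t))"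
  proof (rule sim_invariantI)
    show "1 \<le> term_length s + term_length t" "(1 :: int) \<le> 1"
      using term_length_pos[of s] term_length_pos[of t] by simp_all
    fix v w assume "sim f g V (term_length s + term_length t) 1 v w"
    note sgn = terms[OF V this]
    assume "satisfies (group_structure C) v (Equal s t)"
    then have "f (term_value (group_structure C) w s) = f (term_value (group_structure C) w t)"
      using sgn by (simp add: sgn_0_0)
    then show "satisfies (group_structure C) w (Equal s t)" using inj by (simp add: inj_eq)
  qed
next
  fix V :: "nat set" and r s t
  assume V: "finite V" "term_vars r \<union> term_vars s \<union> term_vars t \<subseteq> V"
  let ?B = "term_length r + term_length s + term_length t"
  show "sim_invariant f g V (\<lambda>v. satisfies (group_structure C) v (Cyc r s t))"
  proof (rule sim_invariantI[OF _ q])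
    note pos = term_length_pos[of r] term_length_pos[of s] term_length_pos[of t]
    show "1 \<le> ?B" using pos by simp
    fix v w assume vw: "sim f g V ?B q v w"
    let ?v = "term_value (group_structure C) v" and ?w = "term_value (group_structure C) w"
    have "?v x mod q = ?w x mod q" if "term_vars x \<subseteq> V" for x
      unfolding term_value_eq_sum[OF V(1) that] using sim_mod[OF vw] by (rule sum_mult_mod_cong)
    then have res: "?v r mod q = ?w r mod q" "?v s mod q = ?w s mod q" "?v t mod q = ?w t mod q"
      using V(2) by simp_all
    have sgn: "sgn (f (?v x) - f (?v y)) = sgn (f (?w x) - f (?w y))"
      if "term_vars x \<union> term_vars y \<subseteq> V" "term_length x + term_length y \<le> ?B" for x y
      using terms[OF V(1) that(1) sim_mono[OF vw that(2) dvd_refl]] .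
    assume "satisfies (group_structure C) v (Cyc r s t)"
    then have "(?v r, ?v s, ?v t) \<in> C" by (simp add: group_structure_def)
    then have "(?w r, ?w s, ?w t) \<in> C"
      using res by (rule C) (rule sgn; use V(2) pos in simp)+
    then show "satisfies (group_structure C) w (Cyc r s t)" by (simp add: group_structure_def)
  qed
qed

section \<open>Rotation numbers of additive cyclic orders\<close>

text \<open>
  Going from \<open>a\<close> to \<open>b\<close> and on to \<open>c\<close> in positive direction, this counts how often \<open>a\<close> is
  passed or reached again. It is the homogeneous Euler cocycle of the cyclic order.
\<close>

definition winding :: "('a \<times> 'a \<times> 'a) set \<Rightarrow> 'a \<Rightarrow> 'a \<Rightarrow> 'a \<Rightarrow> int" where
  "winding C a b c = (if a = b \<or> b = c \<or> (a, b, c) \<in> C then 0 else 1)"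

lemma cyclic_orderD:
  assumes "cyclic_order_on UNIV C"
  shows "(a, b, c) \<in> C \<Longrightarrow> (b, c, a) \<in> C"
    and "(a, b, c) \<in> C \<Longrightarrow> (c, b, a) \<notin> C"
    and "(a, b, c) \<in> C \<Longrightarrow> (a, c, d) \<in> C \<Longrightarrow> (a, b, d) \<in> C"
    and "a \<noteq> b \<Longrightarrow> b \<noteq> c \<Longrightarrow> a \<noteq> c \<Longrightarrow> (a, b, c) \<in> C \<or> (c, b, a) \<in> C"
proof -
  note ax = assms[unfolded cyclic_order_on_def ball_UNIV, THEN conjunct2]
  show "(a, b, c) \<in> C \<Longrightarrow> (b, c, a) \<in> C"
    using ax[THEN conjunct1] by blast
  show "(a, b, c) \<in> C \<Longrightarrow> (c, b, a) \<notin> C"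
    using ax[THEN conjunct2, THEN conjunct1] by blast
  show "(a, b, c) \<in> C \<Longrightarrow> (a, c, d) \<in> C \<Longrightarrow> (a, b, d) \<in> C"
    using ax[THEN conjunct2, THEN conjunct2, THEN conjunct1, rule_format, of a b c d] by blast
  show "a \<noteq> b \<Longrightarrow> b \<noteq> c \<Longrightarrow> a \<noteq> c \<Longrightarrow> (a, b, c) \<in> C \<or> (c, b, a) \<in> C"
    using ax[THEN conjunct2, THEN conjunct2, THEN conjunct2, rule_format, of a b c] by blast
qed

lemma cyclic_order_distinct:
  assumes "cyclic_order_on UNIV C" "(a, b, c) \<in> C"
  shows "a \<noteq> b" "b \<noteq> c" "a \<noteq> c"
  using cyclic_orderD(1,2)[OF assms(1)] assms(2) by metis+

lemma mem_iff_winding: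
  assumes "cyclic_order_on UNIV C"
  shows "(a, b, c) \<in> C \<longleftrightarrow> a \<noteq> b \<and> b \<noteq> c \<and> winding C a b c = 0"
  using cyclic_order_distinct[OF assms, of a b c] by (auto simp: winding_def)

text \<open>
  Both sides count the full turns on the way from \<open>a\<close> through \<open>b\<close> and \<open>c\<close> to \<open>d\<close>. The axioms of a
  cyclic order give this by cases, according to which of the points coincide.
\<close>

lemma winding_cocycle:
  assumes "cyclic_order_on UNIV C"
  shows "winding C b c d + winding C a b d = winding C a c d + winding C a b c"
proof -
  note rot = cyclic_orderD(1)[OF assms] and asym = cyclic_orderD(2)[OF assms]
    and tr = cyclic_orderD(3)[OF assms] and tot = cyclic_orderD(4)[OF assms]
  note dist = cyclic_order_distinct[OF assms]
  consider "a = b" | "b = c" | "c = d" | "a = c" "a \<noteq> b" "c \<noteq> d" | "b = d" "a \<noteq> b" "b \<noteq> c" "a \<noteq> c"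
    | "a = d" "a \<noteq> b" "b \<noteq> c" "a \<noteq> c"
    | "a \<noteq> b" "b \<noteq> c" "c \<noteq> d" "a \<noteq> c" "b \<noteq> d" "a \<noteq> d" by blast
  then show ?thesis
  proof cases
    case 4
    then have "winding C a b c = 1" "winding C a c d = 0" using dist(3) by (auto simp: winding_def)
    moreover have "winding C b c d + winding C a b d = 1"
    proof (cases "b = d")
      case True
      then show ?thesis using 4 dist(3) by (auto simp: winding_def)
    next
      case False
      then have "(b, a, d) \<in> C \<longleftrightarrow> (a, b, d) \<notin> C" using 4 rot asym tot by metis
      then show ?thesis using 4 False by (auto simp: winding_def)
    qed
    ultimately show ?thesis by simp
  next
    case 5
    then have "winding C b c d = 1" "winding C a b d = 0" using dist(3) by (auto simp: winding_def)
    moreover have "(a, c, b) \<in> C \<longleftrightarrow> (a, b, c) \<notin> C" using 5 rot asym tot by metis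
    ultimately show ?thesis using 5 by (auto simp: winding_def)
  next
    case 6
    then have "winding C a b d = 1" "winding C a c d = 1" using dist(3) by (auto simp: winding_def)
    moreover have "(b, c, a) \<in> C \<longleftrightarrow> (a, b, c) \<in> C" using rot by metis
    ultimately show ?thesis using 6 by (auto simp: winding_def)
  next
    case 7
    have 1: "(a, b, c) \<in> C \<longleftrightarrow> (a, c, b) \<notin> C" "(a, b, d) \<in> C \<longleftrightarrow> (a, d, b) \<notin> C"
      "(a, c, d) \<in> C \<longleftrightarrow> (a, d, c) \<notin> C" "(b, c, d) \<in> C \<longleftrightarrow> (b, d, c) \<notin> C"
      using 7 rot asym tot by metis+
    have "(a, b, c) \<in> C \<Longrightarrow> (a, c, d) \<in> C \<Longrightarrow> (a, b, d) \<in> C \<and> (b, c, d) \<in> C"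
      using tr rot by meson
    moreover have "(a, b, c) \<in> C \<Longrightarrow> (a, d, c) \<in> C \<Longrightarrow> (a, b, d) \<in> C \<longleftrightarrow> (b, d, c) \<in> C"
      using tr rot 1 by meson
    moreover have "(a, c, b) \<in> C \<Longrightarrow> (a, c, d) \<in> C \<Longrightarrow> (a, b, d) \<in> C \<longleftrightarrow> (b, d, c) \<in> C"
      using tr rot 1 by meson
    moreover have "(a, c, b) \<in> C \<Longrightarrow> (a, d, c) \<in> C \<Longrightarrow> (a, d, b) \<in> C \<and> (b, d, c) \<in> C"
      using tr rot by meson
    ultimately show ?thesis using 7 1 by (auto simp: winding_def)
  qed (auto simp: winding_def)
qed

lemma winding_translate:
  fixes C :: "('a :: ab_group_add \<times> 'a \<times> 'a) set"
  assumes "additive_cyclic_order C"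
  shows "winding C (a + d) (b + d) (c + d) = winding C a b c"
proof -
  have add: "(a, b, c) \<in> C \<Longrightarrow> (a + d, b + d, c + d) \<in> C" for a b c d
    using assms by (simp add: additive_cyclic_order_def)
  have "(a + d, b + d, c + d) \<in> C \<longleftrightarrow> (a, b, c) \<in> C"
    using add[of "a + d" "b + d" "c + d" "- d"] add[of a b c d] by auto
  then show ?thesis by (simp add: winding_def)
qed

lemma int_antidifference: "\<exists>w. w 0 = 0 \<and> (\<forall>n. w (n + 1) = w n + h n)" for h :: "int \<Rightarrow> int"
proof -
  define w where "w n = (if 0 \<le> n then sum h {0..<n} else - sum h {n..<0})" for n
  have "w (n + 1) = w n + h n" for n
  proof -
    consider "0 \<le> n" | "n = -1" | "n < -1" by linarith
    then show ?thesis
    proof cases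
      case 1
      then have "{0..<n + 1} = insert n {0..<n}" by auto
      then show ?thesis using 1 by (simp add: w_def)
    next
      case 2
      have "{-1..<0 :: int} = {-1}" by auto
      then show ?thesis using 2 by (simp add: w_def)
    next
      case 3
      then have "{n..<0} = insert n {n + 1..<0}" by auto
      then show ?thesis using 3 by (simp add: w_def)
    qed
  qed
  moreover have "w 0 = 0" by (simp add: w_def)
  ultimately show ?thesis by blast
qed

text \<open>
  Every two-cocycle on \<open>\<int>\<close> is a coboundary: \<open>w\<close> is determined by its increments \<open>winding C 0 n (n + 1)\<close>, and
  the cocycle identity extends the relation from increment \<open>1\<close> to all increments.
\<close>

lemma winding_is_coboundary:
  fixes C :: "(int \<times> int \<times> int) set"
  assumes "additive_cyclic_order C"
  shows "\<exists>w. \<forall>a b c. winding C a b c = w (c - a) - w (b - a) - w (c - b)"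
proof -
  have C: "cyclic_order_on UNIV C" using assms by (simp add: additive_cyclic_order_def)
  obtain w where w: "w 0 = 0" "\<And>n. w (n + 1) = w n + winding C 0 n (n + 1)"
    using int_antidifference[of "\<lambda>n. winding C 0 n (n + 1)"] by blast
  have inc: "w (n + (m + 1)) - w (m + 1) - winding C 0 n (n + (m + 1)) = w (n + m) - w m - winding C 0 n (n + m)" for n m
  proof -
    have "winding C n (n + m) (n + m + 1) + winding C 0 n (n + m + 1)
        = winding C 0 (n + m) (n + m + 1) + winding C 0 n (n + m)"
      by (rule winding_cocycle[OF C])
    moreover have "winding C n (n + m) (n + m + 1) = winding C 0 m (m + 1)"
      using winding_translate[OF assms, of 0 n m "m + 1"] by (simp add: ac_simps)
    ultimately show ?thesis using w(2)[of "n + m"] w(2)[of m] by (simp add: ac_simps)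
  qed
  have w_add: "w (n + m) - w m - winding C 0 n (n + m) = w n" for n m
  proof (induction m rule: int_induct[of _ 0])
    case base
    then show ?case using w(1) by (simp add: winding_def)
  next
    case (step1 m)
    then show ?case using inc[of n m] by simp
  next
    case (step2 m)
    then show ?case using inc[of n "m - 1"] by simp
  qed
  have "winding C a b c = w (c - a) - w (b - a) - w (c - b)" for a b c
    using w_add[of "b - a" "c - b"] winding_translate[OF assms, of 0 a "b - a" "c - a"] by simp
  then show ?thesis by blast
qed

definition quasi_additive :: "(int \<Rightarrow> int) \<Rightarrow> bool" where
  "quasi_additive w \<longleftrightarrow> (\<forall>n m. w n + w m \<le> w (n + m) \<and> w (n + m) \<le> w n + w m + 1)"

lemma quasi_additive_multiple:
  assumes "quasi_additive w" "0 < k"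
  shows "k * w n \<le> w (k * n)" "w (k * n) \<le> k * w n + k - 1"
proof -
  have "k * w n \<le> w (k * n) \<and> w (k * n) \<le> k * w n + k - 1"
    using assms(2)
  proof (induction k rule: int_gr_induct)
    case (step k)
    have "w (k * n) + w n \<le> w (k * n + n)" "w (k * n + n) \<le> w (k * n) + w n + 1"
      using assms(1) by (auto simp: quasi_additive_def)
    then show ?case using step by (simp add: algebra_simps)
  qed simp
  then show "k * w n \<le> w (k * n)" "w (k * n) \<le> k * w n + k - 1" by auto
qed

text \<open>
  By quasi-additivity the quotients \<open>w n / n\<close> are at most \<open>(w m + 1) / m\<close> for all positive \<open>n\<close>, \<open>m\<close>;
  their supremum is the rotation number.
\<close>

lemma rotation_number:
  assumes w: "quasi_additive w" and neg: "\<And>n. n \<noteq> 0 \<Longrightarrow> w (- n) = - w n - 1" and w0: "w 0 = 0"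
  shows "\<exists>\<alpha> :: real. \<forall>n. of_int (w n) \<le> of_int n * \<alpha> \<and> of_int n * \<alpha> \<le> of_int (w n) + 1"
proof -
  define A where "A = (\<lambda>n. real_of_int (w n) / of_int n) ` {0<..}"
  have bound: "x \<le> (of_int (w m) + 1) / of_int m" if x: "x \<in> A" and m: "0 < m" for x m
  proof -
    obtain n where n: "0 < n" "x = of_int (w n) / of_int n" using x by (auto simp: A_def)
    have "m * w n \<le> w (m * n)" using w m by (rule quasi_additive_multiple)
    also have "\<dots> \<le> n * w m + n - 1" using quasi_additive_multiple(2)[OF w n(1), of m] by (simp add: mult.commute)
    finally have "m * w n \<le> n * (w m + 1)" by (simp add: algebra_simps)
    then have "real_of_int m * of_int (w n) \<le> of_int n * (of_int (w m) + 1)"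
      by (metis of_int_le_iff of_int_mult of_int_add of_int_1)
    then show ?thesis unfolding n(2) using n(1) m by (simp add: field_simps)
  qed
  have A: "A \<noteq> {}" "bdd_above A"
    using bound[of _ 1] by (auto simp: A_def intro!: bdd_aboveI)
  define \<alpha> where "\<alpha> = Sup A"
  have pos: "of_int (w n) \<le> of_int n * \<alpha> \<and> of_int n * \<alpha> \<le> of_int (w n) + 1" if "0 < n" for n
  proof -
    have "of_int (w n) / of_int n \<le> \<alpha>"
      unfolding \<alpha>_def using that A(2) by (intro cSup_upper) (auto simp: A_def)
    moreover have "\<alpha> \<le> (of_int (w n) + 1) / of_int n"
      unfolding \<alpha>_def using A(1) bound[OF _ that] by (rule cSup_least)
    ultimately show ?thesis using that by (simp add: field_simps)
  qed
  have "of_int (w n) \<le> of_int n * \<alpha> \<and> of_int n * \<alpha> \<le> of_int (w n) + 1" for n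
  proof -
    consider "0 < n" | "n = 0" | "0 < - n" by linarith
    then show ?thesis
    proof cases
      case 3
      then show ?thesis using pos[OF 3] neg[of n] by auto
    qed (use pos w0 in auto)
  qed
  then show ?thesis by blast
qed

lemma additive_cyclic_order_rotation_number:
  fixes C :: "(int \<times> int \<times> int) set"
  assumes "additive_cyclic_order C"
  obtains w and \<alpha> :: real where
    "\<And>a b c. winding C a b c = w (c - a) - w (b - a) - w (c - b)"
    "quasi_additive w" "\<And>n. n \<noteq> 0 \<Longrightarrow> w (- n) = - w n - 1"
    "\<And>n. of_int (w n) \<le> of_int n * \<alpha>" "\<And>n. of_int n * \<alpha> \<le> of_int (w n) + 1"
proof -
  obtain w where w: "\<And>a b c. winding C a b c = w (c - a) - w (b - a) - w (c - b)"
    using winding_is_coboundary[OF assms] by blast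
  have w0: "w 0 = 0" using w[of 0 0 0] by (simp add: winding_def)
  have add: "winding C 0 n (n + m) = w (n + m) - w n - w m" for n m using w[of 0 n "n + m"] by simp
  have qa: "quasi_additive w"
    unfolding quasi_additive_def
  proof (intro allI)
    fix n m
    have "0 \<le> winding C 0 n (n + m)" "winding C 0 n (n + m) \<le> 1" by (simp_all add: winding_def)
    then show "w n + w m \<le> w (n + m) \<and> w (n + m) \<le> w n + w m + 1" unfolding add by linarith
  qed
  have neg: "w (- n) = - w n - 1" if "n \<noteq> 0" for n
  proof -
    have "(0, n, 0) \<notin> C" using cyclic_order_distinct(3) assms by (metis additive_cyclic_order_def)
    then have "winding C 0 n 0 = 1" using that by (simp add: winding_def)
    then show ?thesis using add[of n "- n"] w0 by simp
  qed
  show ?thesis using rotation_number[OF qa neg w0] that[OF w qa neg] by blast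
qed

lemma mem_if_winding_eq:
  assumes "cyclic_order_on UNIV C" "(a, b, c) \<in> C" "winding C a' b' c' = winding C a b c" "a' \<noteq> b'" "b' \<noteq> c'"
  shows "(a', b', c') \<in> C"
  using assms mem_iff_winding[OF assms(1)] by metis

lemma floor_diff_frac:
  "\<lfloor>x - y\<rfloor> = \<lfloor>x\<rfloor> - \<lfloor>y\<rfloor> - (if frac x < frac y then 1 else (0 :: int))" for x y :: real
proof (rule floor_unique)
  have "of_int \<lfloor>x\<rfloor> \<le> x" "x < of_int \<lfloor>x\<rfloor> + 1" "of_int \<lfloor>y\<rfloor> \<le> y" "y < of_int \<lfloor>y\<rfloor> + 1" by linarith+
  then show "of_int (\<lfloor>x\<rfloor> - \<lfloor>y\<rfloor> - (if frac x < frac y then 1 else 0)) \<le> x - y"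
    "x - y < of_int (\<lfloor>x\<rfloor> - \<lfloor>y\<rfloor> - (if frac x < frac y then 1 else 0)) + 1"
    by (cases "frac x < frac y"; simp add: frac_def; linarith)+
qed

lemma inj_frac_mult_irrational:
  fixes \<alpha> :: real
  assumes "\<alpha> \<notin> \<rat>"
  shows "inj (\<lambda>n :: int. frac (of_int n * \<alpha>))"
proof (rule injI)
  fix n m :: int assume "frac (of_int n * \<alpha>) = frac (of_int m * \<alpha>)"
  then have "of_int (n - m) * \<alpha> = of_int (\<lfloor>of_int n * \<alpha>\<rfloor> - \<lfloor>of_int m * \<alpha>\<rfloor>)"
    by (simp add: frac_def algebra_simps)
  then show "n = m" using irrational_combination[OF assms] by fastforce
qed

text \<open>
  Here \<open>w n = \<lfloor>n\<alpha>\<rfloor>\<close> because \<open>n\<alpha>\<close> is not an integer for \<open>n \<noteq> 0\<close>. A difference of integer parts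
  is expressed by comparing fractional parts, and so the winding number is a function of the order of the
  three values of \<open>f\<close>.
\<close>

lemma irrational_rotation_invariance:
  fixes C :: "(int \<times> int \<times> int) set" and \<alpha> :: real
  defines "f \<equiv> \<lambda>n :: int. frac (of_int n * \<alpha>)"
  assumes C: "cyclic_order_on UNIV C" and irr: "\<alpha> \<notin> \<rat>"
    and w: "\<And>a b c. winding C a b c = w (c - a) - w (b - a) - w (c - b)"
    and lower: "\<And>n. of_int (w n) \<le> of_int n * \<alpha>" and upper: "\<And>n. of_int n * \<alpha> \<le> of_int (w n) + 1"
    and mem: "(a, b, c) \<in> C"
    and sgn: "sgn (f a - f b) = sgn (f a' - f b')" "sgn (f b - f c) = sgn (f b' - f c')"
      "sgn (f a - f c) = sgn (f a' - f c')"
  shows "(a', b', c') \<in> C"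
proof (rule mem_if_winding_eq[OF C mem])
  have floor: "w n = \<lfloor>of_int n * \<alpha>\<rfloor>" for n
  proof -
    have "of_int n * \<alpha> \<noteq> of_int (w n) + 1"
    proof
      assume eq: "of_int n * \<alpha> = of_int (w n) + 1"
      then have "of_int n * \<alpha> = of_int (w n + 1)" by simp
      then have "n = 0" by (rule irrational_combination(1)[OF irr])
      then have "w 0 = -1" using eq by simp
      moreover have "w 0 = 0" using w[of 0 0 0] by (simp add: winding_def)
      ultimately show False by simp
    qed
    then show ?thesis using lower[of n] upper[of n] by (intro floor_unique[symmetric]) auto
  qed
  have "w (y - x) = \<lfloor>of_int y * \<alpha>\<rfloor> - \<lfloor>of_int x * \<alpha>\<rfloor> - (if f y < f x then 1 else 0)" for x y
    unfolding floor f_def using floor_diff_frac[of "of_int y * \<alpha>" "of_int x * \<alpha>"] by (simp add: left_diff_distrib)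
  then have wind: "winding C x y z = (if f y < f x then 1 else 0) + (if f z < f y then 1 else 0) - (if f z < f x then 1 else 0)"
    for x y z unfolding w by simp
  have less: "f y < f x \<longleftrightarrow> f y' < f x'" if "sgn (f x - f y) = sgn (f x' - f y')" for x y x' y'
    using that by (auto simp: sgn_if split: if_splits)
  show "winding C a' b' c' = winding C a b c"
    unfolding wind less[OF sgn(1)] less[OF sgn(2)] less[OF sgn(3)] ..
  have ne: "x' \<noteq> y'" if "x \<noteq> y" "sgn (f x - f y) = sgn (f x' - f y')" for x y x' y'
  proof
    assume "x' = y'"
    then have "f x = f y" using that(2) by (simp add: sgn_0_0)
    then have "x = y" unfolding f_def by (rule injD[OF inj_frac_mult_irrational[OF irr]])
    then show False using that(1) by simp
  qed
  show "a' \<noteq> b'" "b' \<noteq> c'" using cyclic_order_distinct[OF C mem] ne sgn by blast+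
qed

text \<open>
  Where \<open>n\<alpha>\<close> is not an integer, \<open>w n\<close> is its integer part. Where it is one, the defect
  \<open>w n - n\<alpha>\<close> is \<open>0\<close> or \<open>-1\<close>; quasi-additivity makes it invariant under positive multiples, hence constant on
  the positive \<open>n\<close> of this kind, as \<open>n\<close> and \<open>m\<close> have the common multiple \<open>n m\<close>.
\<close>

lemma rational_rotation_defect:
  fixes \<alpha> :: real
  assumes qa: "quasi_additive w" and neg: "\<And>n. n \<noteq> 0 \<Longrightarrow> w (- n) = - w n - 1"
    and lower: "\<And>n. of_int (w n) \<le> of_int n * \<alpha>" and upper: "\<And>n. of_int n * \<alpha> \<le> of_int (w n) + 1"
    and q: "of_int q * \<alpha> = of_int p"
    and nm: "n mod q = m mod q" "sgn n = sgn m"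
  shows "of_int (w n) - of_int n * \<alpha> = of_int (w m) - of_int m * \<alpha>"
proof -
  define \<delta> where "\<delta> n = of_int (w n) - of_int n * \<alpha>" for n
  have mult: "\<delta> (k * n) = \<delta> n" if k: "0 < k" and int: "of_int n * \<alpha> = of_int l" for k n l
  proof -
    have "w n = l \<or> w n = l - 1" using lower[of n] upper[of n] unfolding int by linarith
    moreover have "w (k * n) = k * l \<or> w (k * n) = k * l - 1"
    proof -
      have "of_int (k * n) * \<alpha> = of_int (k * l)" using int by (simp add: mult.assoc)
      then show ?thesis using lower[of "k * n"] upper[of "k * n"] by linarith
    qed
    ultimately have "w (k * n) - k * l = w n - l"
      using quasi_additive_multiple[OF qa k, of n] by (auto simp: algebra_simps)
    then have "real_of_int (w (k * n)) - of_int k * of_int l = of_int (w n) - of_int l"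
      by (metis of_int_diff of_int_mult)
    then show ?thesis unfolding \<delta>_def using int by (simp add: mult.assoc)
  qed
  have int_pos: "\<delta> n = \<delta> m" if "0 < n" "0 < m" "of_int n * \<alpha> = of_int l" "of_int m * \<alpha> = of_int l'" for n m l l'
    using mult[OF that(2,3)] mult[OF that(1,4)] by (simp add: mult.commute)
  have \<delta>_neg: "\<delta> (- n) = - \<delta> n - 1" if "n \<noteq> 0" for n
    using neg[OF that] by (simp add: \<delta>_def)
  have "q dvd m - n" using nm(1)[symmetric] by (simp add: mod_eq_dvd_iff)
  then obtain t where t: "m - n = q * t" by (rule dvdE)
  have m_eq: "of_int m * \<alpha> = of_int n * \<alpha> + of_int (p * t)"
  proof -
    have "m = n + q * t" using t by simp
    then have "of_int m * \<alpha> = of_int n * \<alpha> + of_int t * (of_int q * \<alpha>)" by (simp add: algebra_simps)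
    then show ?thesis using q by (simp add: mult.commute)
  qed
  have "\<delta> n = \<delta> m"
  proof (cases "of_int n * \<alpha> \<in> \<int>")
    case False
    have floor: "w x = \<lfloor>of_int x * \<alpha>\<rfloor>" if "of_int x * \<alpha> \<notin> \<int>" for x
    proof -
      have "of_int x * \<alpha> \<noteq> of_int (w x + 1)" using that by (metis Ints_of_int)
      then show ?thesis using lower[of x] upper[of x] by (intro floor_unique[symmetric]) auto
    qed
    have "of_int m * \<alpha> \<notin> \<int>" using False m_eq Ints_diff[of "of_int m * \<alpha>" "of_int (p * t)"] by auto
    then have "w m = \<lfloor>of_int m * \<alpha>\<rfloor>" by (rule floor)
    then have "w m = w n + p * t" unfolding floor[OF False] m_eq floor_add_int .
    then show ?thesis unfolding \<delta>_def m_eq by simp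
  next
    case True
    then obtain l where l: "of_int n * \<alpha> = of_int l" by (auto elim: Ints_cases)
    then have l': "of_int m * \<alpha> = of_int (l + p * t)" using m_eq by simp
    consider "n = 0" "m = 0" | "0 < n" "0 < m" | "0 < - n" "0 < - m"
      using nm(2) by (auto simp: sgn_if split: if_splits)
    then show ?thesis
    proof cases
      case 2
      then show ?thesis using int_pos l l' by blast
    next
      case 3
      have "of_int (- n) * \<alpha> = of_int (- l)" "of_int (- m) * \<alpha> = of_int (- (l + p * t))"
        using l l' by simp_all
      then have "\<delta> (- n) = \<delta> (- m)" using 3 int_pos by blast
      then show ?thesis using \<delta>_neg[of n] \<delta>_neg[of m] 3 by simp
    qed simp
  qed
  then show ?thesis by (simp add: \<delta>_def)
qed

text \<open>
  The linear parts cancel in the coboundary, so only the defects contribute.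
\<close>

lemma rational_rotation_invariance:
  fixes C :: "(int \<times> int \<times> int) set" and \<alpha> :: real
  assumes C: "cyclic_order_on UNIV C"
    and w: "\<And>a b c. winding C a b c = w (c - a) - w (b - a) - w (c - b)"
    and qa: "quasi_additive w" and neg: "\<And>n. n \<noteq> 0 \<Longrightarrow> w (- n) = - w n - 1"
    and lower: "\<And>n. of_int (w n) \<le> of_int n * \<alpha>" and upper: "\<And>n. of_int n * \<alpha> \<le> of_int (w n) + 1"
    and q: "of_int q * \<alpha> = of_int p"
    and mem: "(a, b, c) \<in> C"
    and res: "a mod q = a' mod q" "b mod q = b' mod q" "c mod q = c' mod q"
    and sgn: "sgn (a - b) = sgn (a' - b')" "sgn (b - c) = sgn (b' - c')" "sgn (a - c) = sgn (a' - c')"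
  shows "(a', b', c') \<in> C"
proof (rule mem_if_winding_eq[OF C mem])
  have \<delta>: "of_int (w (y - x)) - of_int (y - x) * \<alpha> = of_int (w (y' - x')) - of_int (y' - x') * \<alpha>"
    if "x mod q = x' mod q" "y mod q = y' mod q" "sgn (x - y) = sgn (x' - y')" for x y x' y'
  proof (rule rational_rotation_defect[OF qa neg lower upper q])
    show "(y - x) mod q = (y' - x') mod q" using that(1,2) by (intro mod_diff_cong) simp_all
    show "sgn (y - x) = sgn (y' - x')" using that(3) by (auto simp: sgn_if split: if_splits)
  qed
  have "real_of_int (winding C x y z) = (of_int (w (z - x)) - of_int (z - x) * \<alpha>)
      - (of_int (w (y - x)) - of_int (y - x) * \<alpha>) - (of_int (w (z - y)) - of_int (z - y) * \<alpha>)" for x y z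
    unfolding w by (simp add: algebra_simps)
  then have "real_of_int (winding C a' b' c') = of_int (winding C a b c)"
    using \<delta>[OF res(1,2) sgn(1)] \<delta>[OF res(2,3) sgn(2)] \<delta>[OF res(1,3) sgn(3)] by simp
  then show "winding C a' b' c' = winding C a b c" by simp
  show "a' \<noteq> b'" "b' \<noteq> c'"
    using cyclic_order_distinct[OF C mem] sgn by (auto simp: sgn_if split: if_splits)
qed

section \<open>Dp-minimality\<close>

theorem theorem2p3:
  fixes C :: "(int \<times> int \<times> int) set"
  assumes "additive_cyclic_order C"
  shows "dp_minimal TYPE('u) (group_structure C)"
proof -
  have C: "cyclic_order_on UNIV C" using assms by (simp add: additive_cyclic_order_def)
  obtain w and \<alpha> :: real where w: "\<And>a b c. winding C a b c = w (c - a) - w (b - a) - w (c - b)"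
    and qa: "quasi_additive w" and neg: "\<And>n. n \<noteq> 0 \<Longrightarrow> w (- n) = - w n - 1"
    and lower: "\<And>n. of_int (w n) \<le> of_int n * \<alpha>" and upper: "\<And>n. of_int n * \<alpha> \<le> of_int (w n) + 1"
    using additive_cyclic_order_rotation_number[OF assms] by blast
  show ?thesis
  proof (cases "\<alpha> \<in> \<rat>")
    case True
    then obtain p q :: int where pq: "0 < q" "\<alpha> = of_int p / of_int q"
      by (rule Rats_cases')
    then have q: "of_int q * \<alpha> = of_int p" by simp
    have sgn_int: "sgn x = sgn y" if "sgn (real_of_int x) = sgn (of_int y)" for x y :: int
      using that by (auto simp: sgn_if split: if_splits)
    show ?thesis
    proof (rule dp_minimal_if_order_and_residues[OF back_and_forth_discrete])
      show "inj real_of_int" by (simp add: inj_def)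
      show "1 \<le> q" using pq(1) by simp
    next
      fix a b c a' b' c'
      assume mem: "(a, b, c) \<in> C"
        and res: "a mod q = a' mod q" "b mod q = b' mod q" "c mod q = c' mod q"
        and sgn: "sgn (real_of_int a - of_int b) = sgn (real_of_int a' - of_int b')"
          "sgn (real_of_int b - of_int c) = sgn (real_of_int b' - of_int c')"
          "sgn (real_of_int a - of_int c) = sgn (real_of_int a' - of_int c')"
      show "(a', b', c') \<in> C"
      proof (rule rational_rotation_invariance[OF C w qa _ lower upper q mem res])
        show "sgn (a - b) = sgn (a' - b')" by (rule sgn_int) (use sgn(1) in simp)
        show "sgn (b - c) = sgn (b' - c')" by (rule sgn_int) (use sgn(2) in simp)
        show "sgn (a - c) = sgn (a' - c')" by (rule sgn_int) (use sgn(3) in simp)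
      qed (rule neg)
    qed (rule sgn_term_diff_discrete)
  next
    case False
    show ?thesis
    proof (rule dp_minimal_if_order_and_residues[OF back_and_forth_dense[OF False]])
      show "inj (\<lambda>n. frac (real_of_int n * \<alpha>))" using False by (rule inj_frac_mult_irrational)
      show "(1 :: int) \<le> 1" by simp
    next
      fix a b c a' b' c'
      assume "(a, b, c) \<in> C"
        and "sgn (frac (of_int a * \<alpha>) - frac (of_int b * \<alpha>)) = sgn (frac (of_int a' * \<alpha>) - frac (of_int b' * \<alpha>))"
          "sgn (frac (of_int b * \<alpha>) - frac (of_int c * \<alpha>)) = sgn (frac (of_int b' * \<alpha>) - frac (of_int c' * \<alpha>))"
          "sgn (frac (of_int a * \<alpha>) - frac (of_int c * \<alpha>)) = sgn (frac (of_int a' * \<alpha>) - frac (of_int c' * \<alpha>))"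
      then show "(a', b', c') \<in> C"
        by (rule irrational_rotation_invariance[OF C False w lower upper])
    qed (rule sgn_term_diff_dense)
  qed
qed

end
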